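(* Let $K$ be a strictly convex domain in $\mathbb R^2$ whose boundary $\partial K$ is an oval, of area $A_{\partial K}$ and perimeter $L_{\partial K}$, let $\widetilde{A}_{\mathrm{CWMS}(\partial K)}$ be the oriented area of the Constant Width Measure Set of $\partial K$, and let $S_K$ be the Steiner symmetral of $K$. Then $$L_{\partial K}^2-4\pi A_{\partial K}-\pi\left|\widetilde{A}_{\mathrm{CWMS}(\partial K)}\right|\geqslant 8\pi^2 d_{\infty}^2(K,S_K),$$ where equality holds if and only if $\partial K$ is centrally symmetric.
   Context: An oval is a $C^\infty$ regular simple closed convex planar curve (signed curvature nowhere zero, of constant sign); orient ovals positively. For an oval $M$ with an origin inside and Minkowski support function $p_M(\theta)$, $M$ is parameterized by $\gamma(\theta)=(p_M\cos\theta-p_M'\sin\theta,\ p_M\sin\theta+p_M'\cos\theta)$. Parallel pairs (ordered pairs of distinct points with parallel tangent lines) are $\gamma(\theta),\gamma(\theta+\pi)$. Constant Width Measure Set: $\mathrm{CWMS}(M)=\{a-b+\frac{L_M}{\pi}\mathbf n(a): a,b\text{ a parallel pair of }M\}$, with $L_M$ the length of $M$ and $\mathbf n(\gamma(\theta))=-(\cos\theta,\sin\theta)$ the unit normal; it is parameterized by $\gamma(\theta)-\gamma(\theta+\pi)+\frac{L_M}{\pi}\mathbf n(\gamma(\theta))$, $\theta\in[0,2\pi]$. The oriented area of an oriented closed curve $C$ is $\widetilde A_C=\frac12\int_C -y\,dx+x\,dy$ (zero if $C$ is a point). The Steiner point of $K$ is $\vec s(K)=\frac1\pi\int_0^{2\pi}(\cos\theta,\sin\theta)\,p_{\partial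 K}(\theta)\,d\theta$. The Steiner symmetral $S_K$ is the centrally symmetric convex body $\frac12(K+(-K))$ (Minkowski addition, $-K=\{-k:k\in K\}$), translated so that its center is the Steiner point of $K$. Its support function is $p_{\partial S_K}(\theta)=\langle\vec s(K),(\cos\theta,\sin\theta)\rangle+\frac12(p_{\partial K}(\theta)+p_{\partial K}(\theta+\pi))$. $d_\infty(K,N)=\max_\theta|p_{\partial K}(\theta)-p_{\partial N}(\theta)|$ is the Hausdorff distance. *)

theory Defs
  imports "HOL-Analysis.Analysis"
begin

definition vderiv :: "(real \<Rightarrow> real^2) \<Rightarrow> real \<Rightarrow> real^2" where
  "vderiv c = (\<lambda>t. vector_derivative c (at t))"

definition smooth_curve :: "(real \<Rightarrow> real^2) \<Rightarrow> bool" where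
  "smooth_curve c \<longleftrightarrow> (\<forall>k t. (vderiv ^^ k) c differentiable at t)"

definition cross2 :: "real^2 \<Rightarrow> real^2 \<Rightarrow> real" where
  "cross2 u v = u$1 * v$2 - u$2 * v$1"

definition signed_curvature :: "(real \<Rightarrow> real^2) \<Rightarrow> real \<Rightarrow> real" where
  "signed_curvature c t =
     cross2 (vderiv c t) (vderiv (vderiv c) t) / norm (vderiv c t) ^ 3"

text \<open>
  A regular parametrization of an oval, with the period normalized to \<open>2 * pi\<close>.
  The fifth conjunct is convexity: the curve lies on one side of each of its tangent lines.
  Either sense of traversal is allowed here; the parametrization \<open>support_param\<close> below
  is the one that fixes the positive orientation.
\<close>

definition oval_param :: "(real \<Rightarrow> real^2) \<Rightarrow> bool" where
  "oval_param c \<longleftrightarrow>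
     smooth_curve c \<and>
     (\<forall>t. vderiv c t \<noteq> 0) \<and>
     (\<forall>t. c (t + 2 * pi) = c t) \<and>
     inj_on c {0..<2 * pi} \<and>
     (\<forall>t. (\<forall>s. 0 \<le> cross2 (vderiv c t) (c s - c t)) \<or>
          (\<forall>s. cross2 (vderiv c t) (c s - c t) \<le> 0)) \<and>
     ((\<forall>t. 0 < signed_curvature c t) \<or> (\<forall>t. signed_curvature c t < 0))"

definition oval :: "(real^2) set \<Rightarrow> bool" where
  "oval M \<longleftrightarrow> (\<exists>c. oval_param c \<and> c ` {0..2 * pi} = M)"

definition curve_length :: "(real \<Rightarrow> real^2) \<Rightarrow> real" where
  "curve_length c = integral {0..2 * pi} (\<lambda>t. norm (vderiv c t))"

text \<open>The length does not depend on the parametrization that is chosen.\<close>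

definition oval_length :: "(real^2) set \<Rightarrow> real" where
  "oval_length M = curve_length (SOME c. oval_param c \<and> c ` {0..2 * pi} = M)"

definition oriented_area :: "(real \<Rightarrow> real^2) \<Rightarrow> real" where
  "oriented_area c =
     (1/2) * integral {0..2 * pi} (\<lambda>t. - (c t $ 2) * (vderiv c t $ 1) + (c t $ 1) * (vderiv c t $ 2))"

definition direction :: "real \<Rightarrow> real^2" where
  "direction \<theta> = vector [cos \<theta>, sin \<theta>]"

text \<open>
  When the origin lies inside \<open>M\<close>, this is the distance from the origin to the tangent line of
  \<open>M\<close> with outer normal \<open>direction \<theta>\<close>; for other positions of the origin it is the signed distance.
\<close>

definition support_fn :: "(real^2) set \<Rightarrow> real \<Rightarrow> real" where
  "support_fn M \<theta> = (SUP x\<in>M. x \<bullet> direction \<theta>)"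

definition support_param :: "(real^2) set \<Rightarrow> real \<Rightarrow> real^2" where
  "support_param M \<theta> =
     vector [support_fn M \<theta> * cos \<theta> - deriv (support_fn M) \<theta> * sin \<theta>,
             support_fn M \<theta> * sin \<theta> + deriv (support_fn M) \<theta> * cos \<theta>]"

text \<open>
  The Constant Width Measure Set \<open>{a - b + (L / pi) *\<^sub>R n a}\<close>, where \<open>a, b\<close> ranges over the
  ordered pairs of distinct points of the oval \<open>M\<close> with parallel tangent lines and \<open>n a\<close> is the
  inner unit normal, as an oriented closed curve with parameter in \<open>[0, 2 * pi]\<close>: the parallel
  pairs are \<open>support_param M \<theta>, support_param M (\<theta> + pi)\<close>, and the unit normal at the first point
  is \<open>- direction \<theta>\<close>.
\<close>

definition CWMS :: "(real^2) set \<Rightarrow> real \<Rightarrow> real^2" where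
  "CWMS M \<theta> = support_param M \<theta> - support_param M (\<theta> + pi)
               + (oval_length M / pi) *\<^sub>R (- direction \<theta>)"

definition strictly_convex_domain :: "(real^2) set \<Rightarrow> bool" where
  "strictly_convex_domain K \<longleftrightarrow>
     compact K \<and> interior K \<noteq> {} \<and>
     (\<forall>x\<in>K. \<forall>y\<in>K. x \<noteq> y \<longrightarrow> open_segment x y \<subseteq> interior K)"

definition steiner_point :: "(real^2) set \<Rightarrow> real^2" where
  "steiner_point K =
     (1 / pi) *\<^sub>R integral {0..2 * pi} (\<lambda>\<theta>. support_fn (frontier K) \<theta> *\<^sub>R direction \<theta>)"

definition minkowski_sum :: "(real^2) set \<Rightarrow> (real^2) set \<Rightarrow> (real^2) set" where
  "minkowski_sum A B = {x + y | x y. x \<in> A \<and> y \<in> B}"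

text \<open>The body \<open>(K + (- K)) / 2\<close> has its center at the origin, whence the translation vector.\<close>

definition steiner_symmetral :: "(real^2) set \<Rightarrow> (real^2) set" where
  "steiner_symmetral K =
     (\<lambda>x. steiner_point K + x) ` ((\<lambda>x. (1/2) *\<^sub>R x) ` minkowski_sum K (uminus ` K))"

text \<open>
  The Hausdorff distance of two convex bodies, as the uniform distance of their support functions.
\<close>

definition d_infty :: "(real^2) set \<Rightarrow> (real^2) set \<Rightarrow> real" where
  "d_infty K N = (SUP \<theta>. \<bar>support_fn (frontier K) \<theta> - support_fn (frontier N) \<theta>\<bar>)"

definition centrally_symmetric :: "(real^2) set \<Rightarrow> bool" where
  "centrally_symmetric M \<longleftrightarrow> (\<exists>z. (\<lambda>x. 2 *\<^sub>R z - x) ` M = M)"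

end

theory Submission
  imports Defs
begin

text \<open>
Write \<open>u(t) = (cos t, sin t)\<close>, let \<open>p\<close> be the support function of \<open>K\<close> and \<open>s\<close> its Steiner point, and split
\<open>p\<close> into the parts that are unchanged and that change sign under \<open>t \<mapsto> t + \<pi>\<close> (the even and the odd part). All quantities of the theorem become
quadratic expressions in \<open>p\<close>: the perimeter is \<open>\<integral>p\<close> (Cauchy), twice the area is \<open>\<integral>(p\<^sup>2 - p'\<^sup>2)\<close>, and the
CWMS is the curve whose support function is \<open>q(t) = p(t) + p(t + \<pi>) - L/\<pi>\<close>. The latter has period \<open>\<pi>\<close> and
mean zero, so by Wirtinger's inequality its oriented area \<open>\<integral>(q\<^sup>2 - q'\<^sup>2)/2\<close> is not positive. Hence the absolute
value in the theorem is a change of sign, and the term it gives cancels exactly the even part of the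
isoperimetric deficit. What is left (\<open>defect_identity\<close>) is \<open>4\<pi> Q(w)\<close>, where
\<open>Q(w) = \<integral> (w'\<^sup>2 - w\<^sup>2)\<close> over \<open>[0, \<pi>]\<close>
and \<open>w(t) = (p(t) - p(t + \<pi>))/2 - s \<bullet> u(t)\<close> is the odd part of \<open>p\<close> with its first harmonics removed.

On the other hand \<open>w\<close> is exactly the difference of the support functions of \<open>K\<close> and of its Steiner symmetral,
so that \<open>d\<^sub>\<infinity>\<close> is the maximum of \<open>|w|\<close>, and the theorem becomes the sharp inequality
\<open>2\<pi> |w(a)|\<^sup>2 \<le> Q(w)\<close> for antiperiodic \<open>w\<close> orthogonal to \<open>cos\<close> and \<open>sin\<close>
(\<open>antiperiodic_sup_bound\<close>). Its extremal function is
\<open>H(t) = (2t - \<pi>) sin t + cos t\<close>, up to a factor the Green's function of \<open>d\<^sup>2/dt\<^sup>2 + 1\<close> on the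
antiperiodic functions without first harmonics: after subtracting
\<open>w(0) H\<close> one is left with a function that vanishes at
\<open>0\<close> and \<open>\<pi>\<close>, for which \<open>Q \<ge> 0\<close> by the Dirichlet form of Wirtinger's inequality. Since \<open>H\<close>, extended
antiperiodically, has a corner at \<open>0\<close> while \<open>w\<close> is differentiable, equality forces \<open>w = 0\<close>, that is
\<open>p(t) - p(t + \<pi>) = 2 s \<bullet> u(t)\<close>, which is central symmetry about \<open>s\<close>.

The geometric input is that \<open>p\<close> is twice continuously differentiable with \<open>p + p'' > 0\<close>
(\<open>support_of_oval\<close>) and the area formula (\<open>area_via_support_function\<close>). The first comes from a global
tangent angle of the given parametrization: nonzero curvature makes it strictly monotone, convexity and
injectivity make it turn exactly once along the curve, and its inverse parametrizes the curve by its normal direction.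
The second comes from an area-preserving parametrization of \<open>K\<close> by a rectangle.
\<close>

section \<open>Integrals of periodic functions\<close>

lemma exists_antiderivative:
  fixes f :: "real \<Rightarrow> real"
  assumes "continuous_on UNIV f"
  obtains F where "\<And>x. (F has_real_derivative f x) (at x)"
proof -
  have "\<exists>F. \<forall>x::real. -\<infinity> < ereal x \<longrightarrow> ereal x < \<infinity> \<longrightarrow> (F has_vector_derivative f x) (at x)"
    by (rule einterval_antiderivative) (use assms in \<open>auto simp: continuous_on_eq_continuous_at\<close>)
  then show ?thesis
    using that by (auto simp: has_real_derivative_iff_has_vector_derivative)
qed

lemma has_integral_of_derivative:
  fixes F :: "real \<Rightarrow> real"
  assumes "\<And>x. (F has_real_derivative f x) (at x)" "a \<le> b"
  shows "(f has_integral (F b - F a)) {a..b}"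
  using assms
  by (intro fundamental_theorem_of_calculus)
     (auto simp: has_real_derivative_iff_has_vector_derivative intro: has_vector_derivative_at_within)

lemma equal_if_derivative_zero:
  fixes f :: "real \<Rightarrow> real"
  assumes "\<And>x. (f has_real_derivative 0) (at x)"
  shows "f x = f y"
  using DERIV_isconst_all[of f x y] assms by auto

lemma integral_over_period:
  fixes f :: "real \<Rightarrow> real"
  assumes cont: "continuous_on UNIV f" and per: "\<And>x. f (x + T) = f x" and "0 \<le> T"
  shows "integral {a..a + T} f = integral {b..b + T} f"
proof -
  obtain F where F: "\<And>x. (F has_real_derivative f x) (at x)"
    using exists_antiderivative[OF cont] by blast
  have I: "integral {c..c + T} f = F (c + T) - F c" for c
    using has_integral_of_derivative[OF F, of c "c + T"] \<open>0 \<le> T\<close> by (simp add: integral_unique)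
  have "((\<lambda>x. F (x + T) - F x) has_real_derivative 0) (at x)" for x
  proof -
    have "((\<lambda>x. F (x + T)) has_real_derivative f (x + T)) (at x)"
      using F[of "x + T"] by (simp add: DERIV_shift)
    from DERIV_diff[OF this F[of x]] show ?thesis by (simp add: per)
  qed
  from equal_if_derivative_zero[of "\<lambda>x. F (x + T) - F x" a b, OF this]
  show ?thesis by (simp add: I)
qed

lemma integral_shift:
  fixes f :: "real \<Rightarrow> real"
  assumes cont: "continuous_on UNIV f" and "a \<le> b"
  shows "integral {a..b} (\<lambda>x. f (x + c)) = integral {a + c..b + c} f"
proof -
  obtain F where F: "\<And>x. (F has_real_derivative f x) (at x)"
    using exists_antiderivative[OF cont] by blast
  have "((\<lambda>x. F (x + c)) has_real_derivative f (x + c)) (at x)" for x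
    using F[of "x + c"] by (simp add: DERIV_shift)
  from has_integral_of_derivative[OF this \<open>a \<le> b\<close>] has_integral_of_derivative[OF F, of "a + c" "b + c"] \<open>a \<le> b\<close>
  show ?thesis by (simp add: integral_unique)
qed

lemma integrable_on_interval:
  fixes f :: "real \<Rightarrow> real"
  assumes "continuous_on UNIV f"
  shows "f integrable_on {a..b}"
  by (rule integrable_continuous_interval) (rule continuous_on_subset[OF assms], simp)

lemma integral_two_halves:
  fixes f :: "real \<Rightarrow> real"
  assumes cont: "continuous_on UNIV f"
  shows "integral {0..2 * pi} f = integral {0..pi} (\<lambda>x. f x + f (x + pi))"
proof -
  have c2: "continuous_on UNIV (\<lambda>x. f (x + pi))"
    by (intro continuous_on_compose2[OF cont] continuous_intros) auto
  have "integral {0..2 * pi} f = integral {0..pi} f + integral {pi..2 * pi} f"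
    by (rule Henstock_Kurzweil_Integration.integral_combine[symmetric])
       (auto intro: integrable_on_interval[OF cont])
  also have "integral {pi..2 * pi} f = integral {0..pi} (\<lambda>x. f (x + pi))"
    using integral_shift[OF cont, of 0 pi pi] by simp
  finally show ?thesis
    by (simp add: Henstock_Kurzweil_Integration.integral_add integrable_on_interval[OF cont] integrable_on_interval[OF c2])
qed

section \<open>Wirtinger's inequality\<close>

text \<open>
At a common zero \<open>a\<close> of \<open>v\<close> and the sine, \<open>v / sin\<close> tends to \<open>v'(a) / cos a\<close>, so the double zero of \<open>v\<^sup>2\<close> beats the
simple pole of the cotangent.
\<close>
lemma square_cot_tendsto_zero:
  fixes v :: "real \<Rightarrow> real"
  assumes v: "(v has_real_derivative D) (at a)" and "v a = 0" "sin a = 0"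
  shows "((\<lambda>t. (v t)\<^sup>2 * cot t) \<longlongrightarrow> 0) (at a)"
proof -
  have "cos a \<noteq> 0" using \<open>sin a = 0\<close> sin_zero_abs_cos_one by fastforce
  have 1: "((\<lambda>t. (v t - v a) / (t - a)) \<longlongrightarrow> D) (at a)"
    using v by (simp add: has_field_derivative_iff)
  have 2: "((\<lambda>t. (sin t - sin a) / (t - a)) \<longlongrightarrow> cos a) (at a)"
    using DERIV_sin[of a] by (simp add: has_field_derivative_iff)
  have "((\<lambda>t. ((v t - v a) / (t - a)) / ((sin t - sin a) / (t - a))) \<longlongrightarrow> D / cos a) (at a)"
    by (rule tendsto_divide[OF 1 2 \<open>cos a \<noteq> 0\<close>])
  then have 3: "((\<lambda>t. v t / sin t) \<longlongrightarrow> D / cos a) (at a)"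
    by (rule Lim_transform_eventually) (auto simp: assms eventually_at_filter)
  have 4: "(v \<longlongrightarrow> 0) (at a)"
    using DERIV_isCont[OF v] \<open>v a = 0\<close> by (simp add: isCont_def)
  have 5: "(cos \<longlongrightarrow> cos a) (at a)"
    using isCont_cos[of a] by (simp add: isCont_def)
  have "((\<lambda>t. v t * (v t / sin t) * cos t) \<longlongrightarrow> 0 * (D / cos a) * cos a) (at a)"
    by (intro tendsto_mult 3 4 5)
  then show ?thesis
    by (simp add: cot_def power2_eq_square)
qed

text \<open>
The identity \<open>v'\<^sup>2 - v\<^sup>2 = (v' - v cot t)\<^sup>2 + (v\<^sup>2 cot t)'\<close> exhibits the integral as the integral of a square,
the boundary terms being zero by \<open>square_cot_tendsto_zero\<close>. Equality means
\<open>v' = v cot t\<close>, whose solutions are the multiples of the sine. To avoid an improper integral, the square is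
recognized as the derivative of the function \<open>G\<close>, which is continuous up to the end points.
\<close>
lemma Wirtinger_Dirichlet:
  fixes v v' :: "real \<Rightarrow> real"
  assumes v: "\<And>t. (v has_real_derivative v' t) (at t)" and cont: "continuous_on UNIV v'"
    and v0: "v 0 = 0" and vpi: "v pi = 0"
  shows "0 \<le> integral {0..pi} (\<lambda>t. (v' t)\<^sup>2 - (v t)\<^sup>2)"
    and "integral {0..pi} (\<lambda>t. (v' t)\<^sup>2 - (v t)\<^sup>2) = 0 \<Longrightarrow> \<exists>c. \<forall>t\<in>{0..pi}. v t = c * sin t"
proof -
  have contv: "continuous_on UNIV v"
    using v by (intro DERIV_continuous_on) auto
  have "continuous_on UNIV (\<lambda>t. (v' t)\<^sup>2 - (v t)\<^sup>2)"
    by (intro continuous_intros cont contv)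
  then obtain F where F: "\<And>t. (F has_real_derivative (v' t)\<^sup>2 - (v t)\<^sup>2) (at t)"
    using exists_antiderivative by blast
  define G where "G = (\<lambda>t. F t - (v t)\<^sup>2 * cot t)"
  have G': "(G has_real_derivative (v' t - v t * cot t)\<^sup>2) (at t)" if "0 < t" "t < pi" for t
  proof -
    have s: "sin t \<noteq> 0" using sin_gt_zero[OF that] by simp
    have e: "inverse (sin t) * inverse (sin t) = 1 + cot t * cot t"
      using sin_cos_squared_add[of t] s by (simp add: cot_def field_simps power2_eq_square)
    show ?thesis unfolding G_def
      by (rule derivative_eq_intros F v DERIV_cot s refl)+
         (simp add: s e power2_eq_square algebra_simps)
  qed
  \<comment> \<open>At the end points \<open>cot\<close> has the value 0, which is the limit of \<open>v\<^sup>2 cot\<close> there.\<close>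
  have contG: "continuous_on {0..pi} G"
  proof (rule continuous_at_imp_continuous_on, rule ballI)
    fix t assume t: "t \<in> {0..pi}"
    have "isCont (\<lambda>t. (v t)\<^sup>2 * cot t) t"
    proof (cases "0 < t \<and> t < pi")
      case True
      then have "sin t \<noteq> 0" using sin_gt_zero[of t] by simp
      then show ?thesis using v by (intro continuous_intros DERIV_isCont[OF v]) auto
    next
      case False
      then have "t = 0 \<or> t = pi" using t by auto
      then show ?thesis
        using square_cot_tendsto_zero[OF v, of t] v0 vpi by (auto simp: isCont_def)
    qed
    with DERIV_isCont[OF F] show "isCont G t" unfolding G_def
      by (rule continuous_diff)
  qed
  have I: "integral {0..pi} (\<lambda>t. (v' t)\<^sup>2 - (v t)\<^sup>2) = G pi - G 0"
    using has_integral_of_derivative[OF F, of 0 pi] by (simp add: integral_unique G_def v0 vpi)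
  have mono: "G a \<le> G b" if "0 \<le> a" "a \<le> b" "b \<le> pi" for a b
  proof (rule DERIV_nonneg_imp_increasing_open[OF \<open>a \<le> b\<close>])
    show "\<exists>y. (G has_real_derivative y) (at x) \<and> 0 \<le> y" if "a < x" "x < b" for x
      using G'[of x] that \<open>0 \<le> a\<close> \<open>b \<le> pi\<close> by force
    show "continuous_on {a..b} G"
      by (rule continuous_on_subset[OF contG]) (use that in auto)
  qed
  show "0 \<le> integral {0..pi} (\<lambda>t. (v' t)\<^sup>2 - (v t)\<^sup>2)"
    using mono[of 0 pi] by (simp add: I)
  assume "integral {0..pi} (\<lambda>t. (v' t)\<^sup>2 - (v t)\<^sup>2) = 0"
  then have const: "G t = G 0" if "0 \<le> t" "t \<le> pi" for t
    using mono[of 0 t] mono[of t pi] that by (simp add: I)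
  have riccati: "v' t = v t * cot t" if t: "0 < t" "t < pi" for t
  proof -
    have "((\<lambda>t. G 0) has_real_derivative (v' t - v t * cot t)\<^sup>2) (at t)"
      by (rule has_field_derivative_transform_within_open[OF G'[OF t], where S = "{0<..<pi}"])
         (use t in \<open>auto intro!: const\<close>)
    then have "(v' t - v t * cot t)\<^sup>2 = 0"
      by (rule DERIV_unique) simp
    then show ?thesis by simp
  qed
  have "v t / sin t = v (pi/2)" if t: "0 < t" "t < pi" for t
  proof -
    have "((\<lambda>t. v t / sin t) has_real_derivative 0) (at t)" if "t \<in> {0<..<pi}" for t
    proof -
      have s: "sin t \<noteq> 0" using sin_gt_zero[of t] that by simp
      show ?thesis
        by (rule derivative_eq_intros v s refl)+
           (use s riccati[of t] that in \<open>simp add: cot_def\<close>)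
    qed
    then obtain c where "\<And>t. t \<in> {0<..<pi} \<Longrightarrow> v t / sin t = c"
      using has_field_derivative_zero_constant[of "{0<..<pi}" "\<lambda>t. v t / sin t"]
      by (metis convex_real_interval(8) has_field_derivative_at_within)
    from this[of t] this[of "pi/2"] t show ?thesis by simp
  qed
  then have inside: "v t = v (pi/2) * sin t" if "0 < t" "t < pi" for t
    using that sin_gt_zero[of t] by (metis less_irrefl nonzero_divide_eq_eq)
  have "v t = v (pi/2) * sin t" if "t \<in> {0..pi}" for t
  proof (cases "t = 0 \<or> t = pi")
    case True
    then show ?thesis using v0 vpi by auto
  next
    case False
    with that show ?thesis by (intro inside) auto
  qed
  then show "\<exists>c. \<forall>t\<in>{0..pi}. v t = c * sin t" by blast
qed

text \<open>
A function of mean zero vanishes somewhere, and by periodicity it vanishes again \<open>\<pi>\<close> later: between these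
two zeros the Dirichlet form applies.
\<close>
lemma Wirtinger_mean_zero:
  fixes e e' :: "real \<Rightarrow> real"
  assumes e: "\<And>t. (e has_real_derivative e' t) (at t)" and cont: "continuous_on UNIV e'"
    and per: "\<And>t. e (t + pi) = e t" and mean: "integral {0..pi} e = 0"
  shows "0 \<le> integral {0..pi} (\<lambda>t. (e' t)\<^sup>2 - (e t)\<^sup>2)"
proof -
  have conte: "continuous_on UNIV e"
    using e by (intro DERIV_continuous_on) auto
  obtain E where E: "\<And>t. (E has_real_derivative e t) (at t)"
    using exists_antiderivative[OF conte] by blast
  have "E pi = E 0"
    using has_integral_of_derivative[OF E, of 0 pi] mean by (simp add: integral_unique)
  then obtain a where a: "e a = 0"
    using MVT2[of 0 pi E e] E by auto
  have per': "e' (t + pi) = e' t" for t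
  proof -
    have "((\<lambda>t. e (t + pi)) has_real_derivative e' (t + pi)) (at t)"
      using e[of "t + pi"] by (simp add: DERIV_shift)
    then show ?thesis using e[of t] by (simp add: per DERIV_unique)
  qed
  define f where "f = (\<lambda>t. (e' t)\<^sup>2 - (e t)\<^sup>2)"
  have contf: "continuous_on UNIV f" unfolding f_def by (intro continuous_intros cont conte)
  have "0 \<le> integral {0..pi} (\<lambda>t. (e' (t + a))\<^sup>2 - (e (t + a))\<^sup>2)"
  proof (rule Wirtinger_Dirichlet)
    show "((\<lambda>t. e (t + a)) has_real_derivative e' (t + a)) (at t)" for t
      using e[of "t + a"] by (simp add: DERIV_shift)
    show "continuous_on UNIV (\<lambda>t. e' (t + a))"
      by (intro continuous_on_compose2[OF cont] continuous_intros) auto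
    show "e (0 + a) = 0" "e (pi + a) = 0"
      using a per[of a] by (simp_all add: add.commute)
  qed
  also have "\<dots> = integral {0 + a..pi + a} f"
    using integral_shift[OF contf, of 0 pi a] by (simp add: f_def)
  also have "\<dots> = integral {0..pi} f"
    using integral_over_period[OF contf, of pi a 0] by (simp add: f_def per per' add.commute)
  finally show ?thesis by (simp add: f_def)
qed

section \<open>A sharp uniform bound for antiperiodic functions\<close>

text \<open>
In Fourier terms, \<open>w\<close> has only odd frequencies \<open>n \<ge> 3\<close>, and the constant comes from Cauchy-Schwarz and
\<open>\<Sum> 1 / (n\<^sup>2 - 1) = 1/4\<close>. The proof here replaces the series by its sum, the function \<open>H\<close>, which satisfies
\<open>H'' + H = 4 cos t\<close> on \<open>[0, \<pi>]\<close>, \<open>H(0) = 1\<close> and \<open>H(\<pi>) = -1\<close>. Because \<open>w\<close> is orthogonal to the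
cosine, the mixed terms in \<open>Q(w) = Q(v + w(0) H)\<close> reduce to boundary terms, which give \<open>2\<pi> w(0)\<^sup>2\<close>.
\<close>
lemma antiperiodic_sup_bound_at_zero:
  fixes w w' :: "real \<Rightarrow> real"
  assumes w: "\<And>t. (w has_real_derivative w' t) (at t)" and cont: "continuous_on UNIV w'"
    and anti: "\<And>t. w (t + pi) = - w t" and orth: "integral {0..pi} (\<lambda>t. w t * cos t) = 0"
  shows "2 * pi * (w 0)\<^sup>2 \<le> integral {0..pi} (\<lambda>t. (w' t)\<^sup>2 - (w t)\<^sup>2)"
    and "integral {0..pi} (\<lambda>t. (w' t)\<^sup>2 - (w t)\<^sup>2) = 2 * pi * (w 0)\<^sup>2 \<Longrightarrow> w 0 = 0"
proof -
  have contw: "continuous_on UNIV w"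
    using w by (intro DERIV_continuous_on) auto
  define H where "H = (\<lambda>t::real. (2 * t - pi) * sin t + cos t)"
  define H' where "H' = (\<lambda>t::real. (2 * t - pi) * cos t + sin t)"
  have H: "(H has_real_derivative H' t) (at t)" for t
    unfolding H_def H'_def by (auto intro!: derivative_eq_intros)
  define v where "v = (\<lambda>t. w t - w 0 * H t)"
  define v' where "v' = (\<lambda>t. w' t - w 0 * H' t)"
  have v: "(v has_real_derivative v' t) (at t)" for t
    unfolding v_def v'_def by (auto intro!: derivative_eq_intros w H)
  have contH': "continuous_on UNIV H'" unfolding H'_def by (intro continuous_intros)
  have contH: "continuous_on UNIV H" unfolding H_def by (intro continuous_intros)
  have contv': "continuous_on UNIV v'" unfolding v'_def by (intro continuous_intros cont contH')
  have contv: "continuous_on UNIV v" unfolding v_def by (intro continuous_intros contw contH)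
  have v0: "v 0 = 0" by (simp add: v_def H_def)
  have vpi: "v pi = 0" using anti[of 0] by (simp add: v_def H_def)
  have HH: "(H' has_real_derivative 4 * cos t - H t) (at t)" for t
    unfolding H_def H'_def by (auto intro!: derivative_eq_intros simp: algebra_simps)
  \<comment> \<open>\<open>J\<close> is an antiderivative of \<open>4 H cos\<close>; it takes the same value at \<open>0\<close> and at \<open>\<pi>\<close>.\<close>
  \<comment> \<open>\<open>R\<close> collects the boundary terms of \<open>Q(w) - Q(v)\<close>.\<close>
  define J where "J = (\<lambda>t::real. 2 * t - (2 * t - pi) * (2 * (cos t)\<^sup>2 - 1) + 4 * (sin t * cos t))"
  have J: "(J has_real_derivative 4 * H t * cos t) (at t)" for t
    unfolding J_def H_def
    by (rule derivative_eq_intros refl)+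
       (simp add: power2_eq_square[symmetric] sin_squared_eq, simp add: algebra_simps power2_eq_square)
  define R where "R = (\<lambda>t. 2 * w 0 * (w t * H' t) - (w 0)\<^sup>2 * (H t * H' t) + (w 0)\<^sup>2 * J t)"
  have R: "(R has_real_derivative
      ((w' t)\<^sup>2 - (w t)\<^sup>2) - ((v' t)\<^sup>2 - (v t)\<^sup>2) + 8 * w 0 * (w t * cos t)) (at t)" for t
    unfolding R_def
    by (rule derivative_eq_intros w H HH J refl)+
       (simp add: v_def v'_def power2_eq_square algebra_simps)
  have "((\<lambda>t. ((w' t)\<^sup>2 - (w t)\<^sup>2) - ((v' t)\<^sup>2 - (v t)\<^sup>2) + 8 * w 0 * (w t * cos t))
      has_integral 2 * pi * (w 0)\<^sup>2) {0..pi}"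
    using has_integral_of_derivative[OF R, of 0 pi] anti[of 0]
    by (simp add: R_def J_def H_def H'_def power2_eq_square algebra_simps)
  moreover have "((\<lambda>t. ((w' t)\<^sup>2 - (w t)\<^sup>2) - ((v' t)\<^sup>2 - (v t)\<^sup>2) + 8 * w 0 * (w t * cos t))
      has_integral (integral {0..pi} (\<lambda>t. (w' t)\<^sup>2 - (w t)\<^sup>2) -
        integral {0..pi} (\<lambda>t. (v' t)\<^sup>2 - (v t)\<^sup>2) + 8 * w 0 * integral {0..pi} (\<lambda>t. w t * cos t))) {0..pi}"
    by (intro has_integral_add has_integral_diff has_integral_mult_right integrable_integral
        integrable_on_interval continuous_intros cont contw contv contv')
  ultimately have Q0: "2 * pi * (w 0)\<^sup>2 = integral {0..pi} (\<lambda>t. (w' t)\<^sup>2 - (w t)\<^sup>2) -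
        integral {0..pi} (\<lambda>t. (v' t)\<^sup>2 - (v t)\<^sup>2) + 8 * w 0 * integral {0..pi} (\<lambda>t. w t * cos t)"
    by (rule has_integral_unique)
  then have Q: "integral {0..pi} (\<lambda>t. (w' t)\<^sup>2 - (w t)\<^sup>2) =
      2 * pi * (w 0)\<^sup>2 + integral {0..pi} (\<lambda>t. (v' t)\<^sup>2 - (v t)\<^sup>2)"
    by (simp add: orth)
  show "2 * pi * (w 0)\<^sup>2 \<le> integral {0..pi} (\<lambda>t. (w' t)\<^sup>2 - (w t)\<^sup>2)"
    using Wirtinger_Dirichlet(1)[OF v contv' v0 vpi] by (simp add: Q)
  assume "integral {0..pi} (\<lambda>t. (w' t)\<^sup>2 - (w t)\<^sup>2) = 2 * pi * (w 0)\<^sup>2"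
  then have "integral {0..pi} (\<lambda>t. (v' t)\<^sup>2 - (v t)\<^sup>2) = 0"
    by (simp add: Q)
  then obtain c where c: "\<And>t. t \<in> {0..pi} \<Longrightarrow> v t = c * sin t"
    using Wirtinger_Dirichlet(2)[OF v contv' v0 vpi] by blast
  \<comment> \<open>Equality makes \<open>v\<close> a multiple of the sine, so \<open>w'\<close> is known at \<open>0\<close> and \<open>\<pi>\<close>, where \<open>w\<close> itself\<close>
  \<comment> \<open>gives \<open>w'(\<pi>) = - w'(0)\<close>; the two are compatible only if the corner coefficient \<open>w(0)\<close> is zero.\<close>
  have v'c: "v' t = c * cos t" if "t \<in> {0<..<pi}" for t
  proof -
    have "((\<lambda>t. c * sin t) has_real_derivative v' t) (at t)"
      by (rule has_field_derivative_transform_within_open[OF v, where S = "{0<..<pi}"]) (use c that in auto)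
    moreover have "((\<lambda>t. c * sin t) has_real_derivative c * cos t) (at t)"
      by (auto intro!: derivative_eq_intros)
    ultimately show ?thesis by (rule DERIV_unique)
  qed
  have cl: "v' t = c * cos t" if "t \<in> {0..pi}" for t
  proof -
    have "v' t - c * cos t = 0"
      by (rule continuous_constant_on_closure[of "{0<..<pi}" "\<lambda>t. v' t - c * cos t"])
         (use that v'c in \<open>auto intro!: continuous_intros continuous_on_subset[OF contv']\<close>)
    then show ?thesis by simp
  qed
  have "((\<lambda>t. w (t + pi)) has_real_derivative w' (0 + pi)) (at 0)"
    using w[of "0 + pi"] by (simp only: DERIV_shift)
  moreover have "((\<lambda>t. w (t + pi)) has_real_derivative - w' 0) (at 0)"
    unfolding anti by (intro derivative_intros w)
  ultimately have "w' pi = - w' 0" by (auto dest: DERIV_unique)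
  with cl[of 0] cl[of pi] have "2 * (w 0 * pi) = 0"
    by (simp add: v'_def H'_def algebra_simps)
  then show "w 0 = 0" by simp
qed

text \<open>
The orthogonality to both \<open>cos\<close> and \<open>sin\<close> is invariant under translations, so the base point can be moved to
\<open>0\<close>.
\<close>
lemma antiperiodic_sup_bound:
  fixes w w' :: "real \<Rightarrow> real"
  assumes w: "\<And>t. (w has_real_derivative w' t) (at t)" and cont: "continuous_on UNIV w'"
    and anti: "\<And>t. w (t + pi) = - w t"
    and orthc: "integral {0..pi} (\<lambda>t. w t * cos t) = 0"
    and orths: "integral {0..pi} (\<lambda>t. w t * sin t) = 0"
  shows "2 * pi * (w a)\<^sup>2 \<le> integral {0..pi} (\<lambda>t. (w' t)\<^sup>2 - (w t)\<^sup>2)"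
    and "integral {0..pi} (\<lambda>t. (w' t)\<^sup>2 - (w t)\<^sup>2) = 2 * pi * (w a)\<^sup>2 \<Longrightarrow> w a = 0"
proof -
  have contw: "continuous_on UNIV w"
    using w by (intro DERIV_continuous_on) auto
  have wa: "((\<lambda>t. w (t + a)) has_real_derivative w' (t + a)) (at t)" for t
    using w[of "t + a"] by (simp add: DERIV_shift)
  have conta: "continuous_on UNIV (\<lambda>t. w' (t + a))"
    by (intro continuous_on_compose2[OF cont] continuous_intros) auto
  have antia: "w (t + pi + a) = - w (t + a)" for t
    using anti[of "t + a"] by (simp add: add_ac)
  have anti': "w' (t + pi) = - w' t" for t
  proof -
    have "((\<lambda>t. w (t + pi)) has_real_derivative w' (t + pi)) (at t)"
      using w[of "t + pi"] by (simp only: DERIV_shift)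
    moreover have "((\<lambda>t. w (t + pi)) has_real_derivative - w' t) (at t)"
      unfolding anti by (intro derivative_intros w)
    ultimately show ?thesis by (rule DERIV_unique)
  qed
  have shift: "integral {0..pi} (\<lambda>t. f (t + a)) = integral {0..pi} f"
    if "continuous_on UNIV f" "\<And>t. f (t + pi) = f t" for f :: "real \<Rightarrow> real"
    using integral_shift[OF that(1), of 0 pi a] integral_over_period[OF that, of a 0]
    by (simp add: add.commute)
  have "integral {0..pi} (\<lambda>t. w (t + a) * cos t)
      = integral {0..pi} (\<lambda>t. (\<lambda>t. cos a * (w t * cos t) + sin a * (w t * sin t)) (t + a))"
  proof (rule integral_cong)
    fix t
    have "cos t = cos (t + a) * cos a + sin (t + a) * sin a"
      using cos_diff[of "t + a" a] by simp
    then show "w (t + a) * cos t = (\<lambda>t. cos a * (w t * cos t) + sin a * (w t * sin t)) (t + a)"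
      by (simp add: algebra_simps)
  qed
  also have "\<dots> = integral {0..pi} (\<lambda>t. cos a * (w t * cos t) + sin a * (w t * sin t))"
    by (rule shift) (auto intro!: continuous_intros contw simp: anti)
  also have "\<dots> = cos a * integral {0..pi} (\<lambda>t. w t * cos t) + sin a * integral {0..pi} (\<lambda>t. w t * sin t)"
    by (intro integral_unique has_integral_add has_integral_mult_right integrable_integral
        integrable_on_interval continuous_intros contw)
  finally have ortha: "integral {0..pi} (\<lambda>t. w (t + a) * cos t) = 0"
    by (simp add: orthc orths)
  have Q: "integral {0..pi} (\<lambda>t. (w' (t + a))\<^sup>2 - (w (t + a))\<^sup>2) = integral {0..pi} (\<lambda>t. (w' t)\<^sup>2 - (w t)\<^sup>2)"
    by (rule shift) (auto intro!: continuous_intros contw cont simp: anti anti')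
  show "2 * pi * (w a)\<^sup>2 \<le> integral {0..pi} (\<lambda>t. (w' t)\<^sup>2 - (w t)\<^sup>2)"
    using antiperiodic_sup_bound_at_zero(1)[OF wa conta antia ortha] by (simp add: Q)
  show "integral {0..pi} (\<lambda>t. (w' t)\<^sup>2 - (w t)\<^sup>2) = 2 * pi * (w a)\<^sup>2 \<Longrightarrow> w a = 0"
    using antiperiodic_sup_bound_at_zero(2)[OF wa conta antia ortha] by (simp add: Q)
qed

section \<open>Supporting lines of plane convex bodies\<close>
lemma inner_direction: "x \<bullet> direction \<theta> = x $ 1 * cos \<theta> + x $ 2 * sin \<theta>"
  by (simp add: direction_def inner_vec_def sum_2)

lemma inner_direction_self [simp]: "direction \<theta> \<bullet> direction \<theta> = 1"
  using sin_cos_squared_add[of \<theta>] by (simp add: inner_direction) (simp add: direction_def power2_eq_square)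

lemma direction_plus_pi: "direction (\<theta> + pi) = - direction \<theta>"
  by (simp add: direction_def vec_eq_iff forall_2)

lemma direction_periodic: "direction (\<theta> + 2 * pi) = direction \<theta>"
  by (simp add: direction_def)

text \<open>
A nonzero linear functional has no maximum at an interior point. This is why the support function of \<open>K\<close>
may be computed on \<open>frontier K\<close>, and why the midpoint of two support points contradicts strict convexity.
\<close>
lemma interior_point_exceeded:
  assumes "m \<in> interior K"
  shows "\<exists>y\<in>K. m \<bullet> direction \<theta> < y \<bullet> direction \<theta>"
proof -
  obtain e where e: "0 < e" "ball m e \<subseteq> K"
    using assms by (auto simp: mem_interior)
  have n: "norm (direction \<theta>) = 1" by (simp add: norm_eq_1)
  have "m + (e/2) *\<^sub>R direction \<theta> \<in> K"
    using e by (intro subsetD[OF e(2)]) (simp add: dist_norm n)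
  moreover have "m \<bullet> direction \<theta> < (m + (e/2) *\<^sub>R direction \<theta>) \<bullet> direction \<theta>"
    using e(1) by (simp add: inner_add_left)
  ultimately show ?thesis by blast
qed

lemma maximizer_in_frontier:
  assumes "closed K" "a \<in> K" "\<And>y. y \<in> K \<Longrightarrow> y \<bullet> direction \<theta> \<le> a \<bullet> direction \<theta>"
  shows "a \<in> frontier K"
  using assms interior_point_exceeded[of a K \<theta>]
  by (force simp: frontier_def)

lemma support_fn_eqI:
  assumes "a \<in> M" "\<And>y. y \<in> M \<Longrightarrow> y \<bullet> direction \<theta> \<le> a \<bullet> direction \<theta>"
  shows "support_fn M \<theta> = a \<bullet> direction \<theta>"
  unfolding support_fn_def using assms by (intro cSup_eq_maximum) auto

lemma support_fn_frontier_eqI: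
  assumes "closed K" "a \<in> K" "\<And>y. y \<in> K \<Longrightarrow> y \<bullet> direction \<theta> \<le> a \<bullet> direction \<theta>"
  shows "support_fn (frontier K) \<theta> = a \<bullet> direction \<theta>"
  using maximizer_in_frontier[OF assms] assms frontier_subset_closed[OF assms(1)]
  by (intro support_fn_eqI) auto

lemma frontier_max_is_max:
  assumes "compact K" "a \<in> frontier K" "\<And>x. x \<in> frontier K \<Longrightarrow> x \<bullet> direction \<theta> \<le> a \<bullet> direction \<theta>"
    and "y \<in> K"
  shows "y \<bullet> direction \<theta> \<le> a \<bullet> direction \<theta>"
proof -
  have "continuous_on K (\<lambda>x. x \<bullet> direction \<theta>)" by (intro continuous_intros)
  then obtain b where b: "b \<in> K" "\<And>x. x \<in> K \<Longrightarrow> x \<bullet> direction \<theta> \<le> b \<bullet> direction \<theta>"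
    using continuous_attains_sup[OF \<open>compact K\<close>] \<open>y \<in> K\<close> by blast
  have "b \<in> frontier K"
    using maximizer_in_frontier[of K b \<theta>] b assms(1) by (auto simp: compact_imp_closed)
  then show ?thesis using assms(3)[of b] b(2)[OF \<open>y \<in> K\<close>] by simp
qed

lemma support_fn_attained:
  assumes "compact K" "K \<noteq> {}"
  obtains b where "b \<in> K" "support_fn (frontier K) \<theta> = b \<bullet> direction \<theta>"
    "\<And>y. y \<in> K \<Longrightarrow> y \<bullet> direction \<theta> \<le> b \<bullet> direction \<theta>"
proof -
  have "continuous_on K (\<lambda>x. x \<bullet> direction \<theta>)" by (intro continuous_intros)
  then obtain b where b: "b \<in> K" "\<And>x. x \<in> K \<Longrightarrow> x \<bullet> direction \<theta> \<le> b \<bullet> direction \<theta>"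
    using continuous_attains_sup[OF assms] by blast
  with support_fn_frontier_eqI[of K b \<theta>] assms(1) that show ?thesis
    by (auto simp: compact_imp_closed)
qed

lemma support_point_unique:
  assumes K: "strictly_convex_domain K"
    and a: "a \<in> frontier K" "\<And>x. x \<in> frontier K \<Longrightarrow> x \<bullet> direction \<theta> \<le> a \<bullet> direction \<theta>"
    and b: "b \<in> frontier K" "\<And>x. x \<in> frontier K \<Longrightarrow> x \<bullet> direction \<theta> \<le> b \<bullet> direction \<theta>"
  shows "a = b"
proof (rule ccontr)
  assume "a \<noteq> b"
  have cK: "compact K" using K by (simp add: strictly_convex_domain_def)
  have "a \<in> K" "b \<in> K" using a(1) b(1) cK compact_imp_closed frontier_subset_closed by blast+
  with K \<open>a \<noteq> b\<close> have "open_segment a b \<subseteq> interior K" by (simp add: strictly_convex_domain_def)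
  then have "midpoint a b \<in> interior K" using \<open>a \<noteq> b\<close> by auto
  then obtain y where "y \<in> K" "midpoint a b \<bullet> direction \<theta> < y \<bullet> direction \<theta>"
    using interior_point_exceeded by blast
  moreover have "midpoint a b \<bullet> direction \<theta> = a \<bullet> direction \<theta>"
    using a(2)[OF b(1)] b(2)[OF a(1)] by (simp add: midpoint_def inner_add_left)
  ultimately show False using frontier_max_is_max[OF cK a, of y] by simp
qed

section \<open>Change of parameter on a periodic curve\<close>
lemma periodic_of_int:
  fixes f :: "real \<Rightarrow> 'a"
  assumes per: "\<And>t. f (t + T) = f t"
  shows "f (t + T * of_int k) = f t"
proof -
  have nat: "f (t + T * real j) = f t" for t j
  proof (induction j)
    case (Suc j)
    then show ?case using per[of "t + T * real j"] by (simp add: algebra_simps)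
  qed simp
  show ?thesis
    using nat[of t "nat k"] nat[of "t + T * of_int k" "nat (- k)"]
    by (cases "0 \<le> k") simp_all
qed

lemma reduce_modulo_period:
  fixes t :: real
  assumes "0 < T"
  obtains k :: int where "t + T * of_int k \<in> {0..<T}"
proof
  have "of_int \<lfloor>t / T\<rfloor> * T \<le> t" "t < (of_int \<lfloor>t / T\<rfloor> + 1) * T"
    using floor_correct[of "t / T"] \<open>0 < T\<close>
    by (simp_all add: pos_le_divide_eq[symmetric] pos_divide_less_eq[symmetric])
  then show "t + T * of_int (- \<lfloor>t / T\<rfloor>) \<in> {0..<T}"
    by (simp add: algebra_simps)
qed

text \<open>
This is used twice: for the tangent angle, whose increment over a period is \<open>2\<pi>\<close>, and for the area swept
from an interior point, whose increment over a period is twice the area.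
\<close>
lemma quasiperiodic_inverse:
  fixes F f :: "real \<Rightarrow> real"
  assumes F: "\<And>t. (F has_real_derivative f t) (at t)" and pos: "\<And>t. 0 < f t"
    and quasi: "\<And>t. F (t + T) = F t + C" and "0 < T"
  obtains G where "\<And>y. F (G y) = y" "\<And>t. G (F t) = t"
    "\<And>y. (G has_real_derivative 1 / f (G y)) (at y)"
proof -
  have mono: "F s < F t" if "s < t" for s t
    using DERIV_pos_imp_increasing[OF that, of F] F pos by blast
  have "0 < C" using mono[of 0 "0 + T"] quasi[of 0] \<open>0 < T\<close> by simp
  have contF: "isCont F t" for t using F by (rule DERIV_isCont)
  have up: "F (real n * T) = F 0 + real n * C" for n
  proof (induction n)
    case (Suc n)
    then show ?case using quasi[of "real n * T"] by (simp add: algebra_simps)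
  qed simp
  have down: "F (- (real n * T)) = F 0 - real n * C" for n
  proof (induction n)
    case (Suc n)
    then show ?case using quasi[of "- (real (Suc n) * T)"] by (simp add: algebra_simps)
  qed simp
  have surj: "\<exists>t. F t = y" for y
  proof -
    obtain n where n: "\<bar>y - F 0\<bar> < real n * C"
      using reals_Archimedean3[OF \<open>0 < C\<close>] by blast
    have "- (real n * T) \<le> real n * T" using \<open>0 < T\<close> by simp
    then show ?thesis
      using IVT[of F "- (real n * T)" y "real n * T"] n contF up[of n] down[of n] by force
  qed
  define G where "G = (\<lambda>y. SOME t. F t = y)"
  have FG: "F (G y) = y" for y unfolding G_def using someI_ex[OF surj] .
  have GF: "G (F t) = t" for t
    using mono[of "G (F t)" t] mono[of t "G (F t)"] FG[of "F t"]
    by (cases rule: linorder_cases[of "G (F t)" t]) auto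
  have contG: "isCont G y" for y
    using isCont_inverse_function[where d = 1 and x = "G y" and f = F and g = G] GF contF FG by simp
  have "(G has_real_derivative 1 / f (G y)) (at y)" for y
    using DERIV_inverse_function[where f = F and g = G and x = y and D = "f (G y)" and a = "y - 1" and b = "y + 1"] F pos[of "G y"] FG contG
    by (auto simp: inverse_eq_divide)
  with FG GF show ?thesis using that by blast
qed

section \<open>The tangent angle\<close>

text \<open>
With \<open>S = X cos \<theta> + Y sin \<theta>\<close> the component of \<open>(X, Y)\<close> along \<open>u(\<theta>)\<close> and \<open>S' = Y cos \<theta> - X sin \<theta>\<close> the one
along \<open>u'(\<theta>)\<close>, this is the expansion \<open>(X, Y) = S u + S' u'\<close>.
\<close>
lemma coordinates_in_rotated_frame:
  fixes X Y \<theta> :: real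
  shows "(X * cos \<theta> + Y * sin \<theta>) * cos \<theta> - (Y * cos \<theta> - X * sin \<theta>) * sin \<theta> = X"
    and "(X * cos \<theta> + Y * sin \<theta>) * sin \<theta> + (Y * cos \<theta> - X * sin \<theta>) * cos \<theta> = Y"
proof -
  have gen: "(X * a + Y * b) * a - (Y * a - X * b) * b = X"
    "(X * a + Y * b) * b + (Y * a - X * b) * a = Y" if "a * a + b * b = 1" for a b :: real
  proof -
    have "(X * a + Y * b) * a - (Y * a - X * b) * b = X * (a * a + b * b)"
      "(X * a + Y * b) * b + (Y * a - X * b) * a = Y * (a * a + b * b)"
      by (simp_all add: algebra_simps)
    then show "(X * a + Y * b) * a - (Y * a - X * b) * b = X"
      "(X * a + Y * b) * b + (Y * a - X * b) * a = Y" by (simp_all add: that)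
  qed
  show "(X * cos \<theta> + Y * sin \<theta>) * cos \<theta> - (Y * cos \<theta> - X * sin \<theta>) * sin \<theta> = X"
    "(X * cos \<theta> + Y * sin \<theta>) * sin \<theta> + (Y * cos \<theta> - X * sin \<theta>) * cos \<theta> = Y"
    by (rule gen, rule sin_cos_squared_add3)+
qed

lemma quotient_constant:
  fixes N n :: "real \<Rightarrow> real"
  assumes N: "(N has_real_derivative N') (at t)" and n: "(n has_real_derivative X / n t) (at t)"
    and "0 < n t" and eq: "n t * n t * N' = N t * X"
  shows "((\<lambda>t. N t / n t) has_real_derivative 0) (at t)"
proof -
  have "((\<lambda>t. N t / n t) has_real_derivative (N' * n t - N t * (X / n t)) / (n t * n t)) (at t)"
    by (rule DERIV_divide[OF N n]) (use \<open>0 < n t\<close> in simp)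
  moreover have "N t * (X / n t) = N' * n t"
    using eq \<open>0 < n t\<close> by (simp add: nonzero_divide_eq_eq mult_ac)
  ultimately show ?thesis by simp
qed

text \<open>
A nonvanishing curve \<open>T = (x1, y1)\<close> has a continuous argument. It is obtained by integrating the known
angular velocity \<open>T \<times> T' / |T|\<^sup>2\<close> from a correct initial value; in the frame rotating with this angle the
unit vector \<open>T / |T|\<close> has derivative zero. The angle \<open>\<phi>\<close> is that of the right-hand normal, so
\<open>T = |T| u'(\<phi>)\<close>.
\<close>
lemma tangent_angle:
  fixes x1 y1 x2 y2 :: "real \<Rightarrow> real"
  assumes x1: "\<And>t. (x1 has_real_derivative x2 t) (at t)" and y1: "\<And>t. (y1 has_real_derivative y2 t) (at t)"
    and cont: "continuous_on UNIV x2" "continuous_on UNIV y2"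
    and nz: "\<And>t. 0 < (x1 t)\<^sup>2 + (y1 t)\<^sup>2"
  obtains \<phi> where
    "\<And>t. (\<phi> has_real_derivative (x1 t * y2 t - y1 t * x2 t) / ((x1 t)\<^sup>2 + (y1 t)\<^sup>2)) (at t)"
    "\<And>t. x1 t = - (sqrt ((x1 t)\<^sup>2 + (y1 t)\<^sup>2) * sin (\<phi> t))"
    "\<And>t. y1 t = sqrt ((x1 t)\<^sup>2 + (y1 t)\<^sup>2) * cos (\<phi> t)"
proof -
  have contT: "continuous_on UNIV x1" "continuous_on UNIV y1"
    using x1 y1 by (auto intro!: DERIV_continuous_on)
  define n where "n = (\<lambda>t. sqrt ((x1 t)\<^sup>2 + (y1 t)\<^sup>2))"
  have npos: "0 < n t" for t using nz by (simp add: n_def)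
  have n2: "(n t)\<^sup>2 = (x1 t)\<^sup>2 + (y1 t)\<^sup>2" for t by (simp add: n_def)
  define \<kappa> where "\<kappa> = (\<lambda>t. (x1 t * y2 t - y1 t * x2 t) / ((x1 t)\<^sup>2 + (y1 t)\<^sup>2))"
  have n': "(n has_real_derivative (x1 t * x2 t + y1 t * y2 t) / n t) (at t)" for t
  proof -
    have "((\<lambda>t. (x1 t)\<^sup>2 + (y1 t)\<^sup>2) has_real_derivative 2 * (x1 t * x2 t + y1 t * y2 t)) (at t)"
      by (auto intro!: derivative_eq_intros x1 y1 simp: algebra_simps)
    from DERIV_chain2[where f = sqrt and x = t and g = "\<lambda>t. (x1 t)\<^sup>2 + (y1 t)\<^sup>2", OF DERIV_real_sqrt[OF nz] this]
    have "(n has_real_derivative inverse (n t) / 2 * (2 * (x1 t * x2 t + y1 t * y2 t))) (at t)"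
      by (simp only: n_def)
    moreover have "inverse (n t) / 2 * (2 * (x1 t * x2 t + y1 t * y2 t)) = (x1 t * x2 t + y1 t * y2 t) / n t"
      using npos[of t] by (simp add: field_simps)
    ultimately show ?thesis by (simp only:)
  qed
  have nz0: "\<forall>t\<in>UNIV. (x1 t)\<^sup>2 + (y1 t)\<^sup>2 \<noteq> 0" using nz by (metis less_irrefl)
  have "continuous_on UNIV \<kappa>" unfolding \<kappa>_def
    by (intro continuous_on_divide nz0 continuous_intros cont contT)
  then obtain F where F: "\<And>t. (F has_real_derivative \<kappa> t) (at t)"
    using exists_antiderivative by blast
  have "(y1 0 / n 0)\<^sup>2 + (- x1 0 / n 0)\<^sup>2 = ((x1 0)\<^sup>2 + (y1 0)\<^sup>2) / (n 0)\<^sup>2"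
    by (simp add: power_divide add_divide_distrib)
  also have "\<dots> = 1"
    unfolding n2[symmetric] using npos[of 0] by simp
  finally have "(y1 0 / n 0)\<^sup>2 + (- x1 0 / n 0)\<^sup>2 = 1" .
  then obtain a where a: "y1 0 / n 0 = cos a" "- x1 0 / n 0 = sin a"
    using sincos_total_2pi by metis
  define \<phi> where "\<phi> = (\<lambda>t. F t - F 0 + a)"
  have \<phi>: "(\<phi> has_real_derivative \<kappa> t) (at t)" for t
    unfolding \<phi>_def by (auto intro!: derivative_eq_intros F)
  define f where "f = (\<lambda>t. (- x1 t * sin (\<phi> t) + y1 t * cos (\<phi> t)) / n t)"
  define g where "g = (\<lambda>t. (x1 t * cos (\<phi> t) + y1 t * sin (\<phi> t)) / n t)"
  have k: "\<kappa> t * (n t * n t) = x1 t * y2 t - y1 t * x2 t" for t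
    using nz[of t] n2[of t] unfolding \<kappa>_def by (simp add: power2_eq_square)
  have f': "(f has_real_derivative 0) (at t)" for t
    unfolding f_def
  proof (rule quotient_constant[OF _ n' npos])
    show "((\<lambda>t. - x1 t * sin (\<phi> t) + y1 t * cos (\<phi> t)) has_real_derivative
      - x2 t * sin (\<phi> t) + y2 t * cos (\<phi> t) - \<kappa> t * (x1 t * cos (\<phi> t) + y1 t * sin (\<phi> t))) (at t)"
      by (auto intro!: derivative_eq_intros x1 y1 \<phi> simp: algebra_simps)
    have "n t * n t * (- x2 t * sin (\<phi> t) + y2 t * cos (\<phi> t)) - (\<kappa> t * (n t * n t)) * (x1 t * cos (\<phi> t) + y1 t * sin (\<phi> t))
       = (- x1 t * sin (\<phi> t) + y1 t * cos (\<phi> t)) * (x1 t * x2 t + y1 t * y2 t)"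
      unfolding k using n2[of t] by (simp add: power2_eq_square) (simp add: algebra_simps)
    then show "n t * n t * (- x2 t * sin (\<phi> t) + y2 t * cos (\<phi> t) - \<kappa> t * (x1 t * cos (\<phi> t) + y1 t * sin (\<phi> t)))
       = (- x1 t * sin (\<phi> t) + y1 t * cos (\<phi> t)) * (x1 t * x2 t + y1 t * y2 t)"
      by (simp add: right_diff_distrib mult_ac)
  qed
  have g': "(g has_real_derivative 0) (at t)" for t
    unfolding g_def
  proof (rule quotient_constant[OF _ n' npos])
    show "((\<lambda>t. x1 t * cos (\<phi> t) + y1 t * sin (\<phi> t)) has_real_derivative
      x2 t * cos (\<phi> t) + y2 t * sin (\<phi> t) + \<kappa> t * (y1 t * cos (\<phi> t) - x1 t * sin (\<phi> t))) (at t)"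
      by (auto intro!: derivative_eq_intros x1 y1 \<phi> simp: algebra_simps)
    have "n t * n t * (x2 t * cos (\<phi> t) + y2 t * sin (\<phi> t)) + (\<kappa> t * (n t * n t)) * (y1 t * cos (\<phi> t) - x1 t * sin (\<phi> t))
       = (x1 t * cos (\<phi> t) + y1 t * sin (\<phi> t)) * (x1 t * x2 t + y1 t * y2 t)"
      unfolding k using n2[of t] by (simp add: power2_eq_square) (simp add: algebra_simps)
    then show "n t * n t * (x2 t * cos (\<phi> t) + y2 t * sin (\<phi> t) + \<kappa> t * (y1 t * cos (\<phi> t) - x1 t * sin (\<phi> t)))
       = (x1 t * cos (\<phi> t) + y1 t * sin (\<phi> t)) * (x1 t * x2 t + y1 t * y2 t)"
      by (simp add: distrib_left mult_ac)
  qed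
  have x0: "x1 0 = - n 0 * sin a" and y0: "y1 0 = n 0 * cos a"
    unfolding a[symmetric] using npos[of 0] by simp_all
  have \<phi>0: "\<phi> 0 = a" by (simp add: \<phi>_def)
  have "f 0 = n 0 * (sin a * sin a + cos a * cos a) / n 0"
    unfolding f_def \<phi>0 x0 y0 distrib_left by (simp only: mult_minus_left minus_minus mult.assoc)
  then have f0: "f 0 = 1"
    using npos[of 0] sin_cos_squared_add3[of a] by (simp add: add.commute)
  have g0: "g 0 = 0"
    unfolding g_def \<phi>0 x0 y0 by simp
  note fg0 = f0 g0
  have fg: "f t = 1" "g t = 0" for t
    using equal_if_derivative_zero[of f t 0, OF f'] equal_if_derivative_zero[of g t 0, OF g'] fg0 by auto
  have "x1 t = - (n t * sin (\<phi> t)) \<and> y1 t = n t * cos (\<phi> t)" for t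
  proof -
    have A: "- x1 t * sin (\<phi> t) + y1 t * cos (\<phi> t) = n t" "x1 t * cos (\<phi> t) + y1 t * sin (\<phi> t) = 0"
      using fg[of t] npos[of t] by (auto simp: f_def g_def)
    have s: "sin (\<phi> t) * sin (\<phi> t) = 1 - cos (\<phi> t) * cos (\<phi> t)"
      using sin_squared_eq[of "\<phi> t"] by (simp add: power2_eq_square)
    have "n t * sin (\<phi> t) = - x1 t * (sin (\<phi> t) * sin (\<phi> t)) + y1 t * cos (\<phi> t) * sin (\<phi> t)"
      by (subst A(1)[symmetric]) (simp add: algebra_simps)
    also have "\<dots> = cos (\<phi> t) * (x1 t * cos (\<phi> t) + y1 t * sin (\<phi> t)) - x1 t"
      unfolding s by (simp add: algebra_simps)
    finally have 1: "x1 t = - (n t * sin (\<phi> t))" using A(2) by simp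
    have "n t * cos (\<phi> t) = - x1 t * sin (\<phi> t) * cos (\<phi> t) + y1 t * (1 - sin (\<phi> t) * sin (\<phi> t))"
      by (subst A(1)[symmetric]) (simp add: s algebra_simps)
    also have "\<dots> = y1 t - sin (\<phi> t) * (x1 t * cos (\<phi> t) + y1 t * sin (\<phi> t))"
      by (simp add: algebra_simps)
    finally have 2: "y1 t = n t * cos (\<phi> t)" using A(2) by simp
    from 1 2 show ?thesis by simp
  qed
  with \<phi> show ?thesis using that[of \<phi>] unfolding n_def \<kappa>_def by blast
qed

lemma has_real_derivative_nth:
  fixes c :: "real \<Rightarrow> real^'n"
  assumes "(c has_vector_derivative d) (at t)"
  shows "((\<lambda>t. c t $ i) has_real_derivative d $ i) (at t)"
  using bounded_linear.has_vector_derivative[OF bounded_linear_vec_nth assms, of i]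
  by (simp add: has_real_derivative_iff_has_vector_derivative)

lemma has_vector_derivative_shift:
  assumes "(f has_vector_derivative D) (at (t + a))"
  shows "((\<lambda>t. f (t + a)) has_vector_derivative D) (at t)"
proof -
  have "((\<lambda>t. t + a) has_vector_derivative 1) (at t)"
    unfolding has_real_derivative_iff_has_vector_derivative[symmetric] by (auto intro!: derivative_eq_intros)
  from vector_diff_chain_at[OF this assms] show ?thesis by (simp add: o_def)
qed

section \<open>The support function of an oval\<close>

text \<open>
For a curve traversed with positive curvature the angle \<open>\<phi>\<close> increases strictly, and \<open>c t\<close> turns out to be
the point of the curve that is extreme in direction \<open>u(\<phi> t)\<close>. Reparametrizing by \<open>\<theta> = \<phi> t\<close> with inverse
\<open>\<psi>\<close> gives \<open>p(\<theta>) = c (\<psi> \<theta>) \<bullet> u(\<theta>)\<close>. The velocity of \<open>c \<circ> \<psi>\<close> is \<open>\<rho> u'\<close> with the radius of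
curvature \<open>\<rho> > 0\<close>, whence \<open>p' = (c \<circ> \<psi>) \<bullet> u'\<close> and \<open>p'' = \<rho> - p\<close>. The length is \<open>\<integral>\<rho> = \<integral>(p + p'') = \<integral>p\<close>.
\<close>
lemma support_of_positive_curve:
  fixes c T T2 :: "real \<Rightarrow> real^2"
  assumes K: "strictly_convex_domain K"
    and c: "\<And>t. (c has_vector_derivative T t) (at t)"
    and T: "\<And>t. (T has_vector_derivative T2 t) (at t)"
    and cont: "continuous_on UNIV T2"
    and M: "range c = frontier K"
    and per: "\<And>t. c (t + 2 * pi) = c t"
    and inj: "\<And>s t. c s = c t \<Longrightarrow> \<exists>k::int. s = t + 2 * pi * k"
    and side: "\<And>t. (\<forall>s. 0 \<le> cross2 (T t) (c s - c t)) \<or> (\<forall>s. cross2 (T t) (c s - c t) \<le> 0)"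
    and curv: "\<And>t. 0 < cross2 (T t) (T2 t)"
  obtains p' p'' where
    "\<And>\<theta>. (support_fn (frontier K) has_real_derivative p' \<theta>) (at \<theta>)"
    "\<And>\<theta>. (p' has_real_derivative p'' \<theta>) (at \<theta>)"
    "continuous_on UNIV p''"
    "\<And>\<theta>. 0 < support_fn (frontier K) \<theta> + p'' \<theta>"
    "integral {0..2 * pi} (support_fn (frontier K)) = integral {0..2 * pi} (\<lambda>t. norm (T t))"
    "range (support_param (frontier K)) = frontier K"
    "\<And>s t. support_param (frontier K) s = support_param (frontier K) t \<Longrightarrow> \<exists>k::int. s = t + 2 * pi * k"
proof -
  define p where "p = support_fn (frontier K)"
  define n where "n = (\<lambda>t. sqrt ((T t $ 1)\<^sup>2 + (T t $ 2)\<^sup>2))"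
  have normT: "norm (T t) = n t" for t
    by (simp add: n_def norm_vec_def L2_set_def sum_2)
  have dc: "((\<lambda>t. c t $ i) has_real_derivative T t $ i) (at t)" for i t
    by (rule has_real_derivative_nth[OF c])
  have dT: "((\<lambda>t. T t $ i) has_real_derivative T2 t $ i) (at t)" for i t
    by (rule has_real_derivative_nth[OF T])
  have contT2: "continuous_on UNIV (\<lambda>t. T2 t $ i)" for i
    using continuous_on_component[OF cont] .
  have contT: "continuous_on UNIV (\<lambda>t. T t $ i)" for i
    using dT by (intro DERIV_continuous_on) auto
  have nz: "0 < (T t $ 1)\<^sup>2 + (T t $ 2)\<^sup>2" for t
  proof -
    have "T t $ 1 \<noteq> 0 \<or> T t $ 2 \<noteq> 0" using curv[of t] by (auto simp: cross2_def)
    then show ?thesis by (simp add: sum_power2_gt_zero_iff)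
  qed
  define \<kappa> where "\<kappa> = (\<lambda>t. (T t $ 1 * T2 t $ 2 - T t $ 2 * T2 t $ 1) / ((T t $ 1)\<^sup>2 + (T t $ 2)\<^sup>2))"
  obtain \<phi> where \<phi>: "\<And>t. (\<phi> has_real_derivative \<kappa> t) (at t)"
    and T1: "\<And>t. T t $ 1 = - (n t * sin (\<phi> t))" and T2: "\<And>t. T t $ 2 = n t * cos (\<phi> t)"
    using tangent_angle[OF dT dT contT2 contT2 nz] unfolding \<kappa>_def n_def by blast
  have npos: "0 < n t" for t using nz by (simp add: n_def)
  have \<kappa>pos: "0 < \<kappa> t" for t using curv[of t] nz[of t] by (simp add: \<kappa>_def cross2_def)
  have mono: "\<phi> s < \<phi> t" if "s < t" for s t
    using DERIV_pos_imp_increasing[OF that, of \<phi>] \<phi> \<kappa>pos by blast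
  \<comment> \<open>The curve lies on one side of its tangent at \<open>c t\<close>; it cannot be the outer side, because just after\<close>
  \<comment> \<open>\<open>t\<close> the positive curvature bends it inwards.\<close>
  have supp: "c s \<bullet> direction (\<phi> t) \<le> c t \<bullet> direction (\<phi> t)" for s t
  proof -
    define h where "h = (\<lambda>s. (c s - c t) \<bullet> direction (\<phi> t))"
    have cr: "cross2 (T t) (c s - c t) = - n t * h s" for s
      by (simp add: cross2_def h_def inner_direction T1 T2 algebra_simps)
    have h': "(h has_real_derivative n s * sin (\<phi> t - \<phi> s)) (at s)" for s
    proof -
      have "(h has_real_derivative T s $ 1 * cos (\<phi> t) + T s $ 2 * sin (\<phi> t)) (at s)"
        unfolding h_def inner_direction
        by (auto intro!: derivative_eq_intros dc)
      then show ?thesis by (simp add: T1 T2 sin_diff algebra_simps)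
    qed
    have "\<not> (\<forall>s. 0 \<le> h s)"
    proof
      assume pos: "\<forall>s. 0 \<le> h s"
      have "isCont \<phi> t" using \<phi> by (rule DERIV_isCont)
      then have "\<forall>\<^sub>F s in at t. dist (\<phi> s) (\<phi> t) < pi"
        unfolding isCont_def by (rule tendstoD) simp
      then obtain d where d: "0 < d" "\<And>s. s \<noteq> t \<Longrightarrow> dist s t < d \<Longrightarrow> dist (\<phi> s) (\<phi> t) < pi"
        unfolding eventually_at by blast
      have "h (t + d/2) < h t"
      proof (rule DERIV_neg_imp_decreasing_open[where f = h and a = t and b = "t + d/2"])
        show "t < t + d/2" using d(1) by simp
        show "\<exists>y. (h has_real_derivative y) (at s) \<and> y < 0" if s: "t < s" "s < t + d/2" for s
        proof -
          have "\<phi> t < \<phi> s" "\<phi> s < \<phi> t + pi"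
            using mono[OF s(1)] d(2)[of s] s by (auto simp: dist_real_def)
          then have "sin (\<phi> s - \<phi> t) > 0" by (intro sin_gt_zero) auto
          then have "sin (\<phi> t - \<phi> s) < 0" using sin_minus[of "\<phi> s - \<phi> t"] by simp
          then show ?thesis using h'[of s] npos[of s] by (auto simp: mult_pos_neg)
        qed
        show "continuous_on {t..t + d/2} h"
          using h' by (intro DERIV_continuous_on) (auto intro: has_field_derivative_at_within)
      qed
      moreover have "h t = 0" by (simp add: h_def)
      ultimately show False using pos by (metis not_less)
    qed
    then have "h s \<le> 0"
      using side[of t] npos[of t] unfolding cr by (auto simp: mult_le_0_iff zero_le_mult_iff)
    then show ?thesis by (simp add: h_def inner_diff_left)
  qed
  have cM: "c t \<in> frontier K" for t using M by blast
  have suppM: "y \<bullet> direction (\<phi> t) \<le> c t \<bullet> direction (\<phi> t)" if "y \<in> frontier K" for y t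
    using that supp M by (metis rangeE)
  have p\<phi>: "p (\<phi> t) = c t \<bullet> direction (\<phi> t)" for t
    unfolding p_def by (intro support_fn_eqI cM suppM)
  have unique: "c s = c t" if "direction (\<phi> s) = direction (\<phi> t)" for s t
    by (rule support_point_unique[OF K, where \<theta> = "\<phi> t"])
       (use suppM[of _ s] suppM[of _ t] that in \<open>auto simp: cM\<close>)
  have Tper: "T (t + 2 * pi) = T t" for t
  proof -
    have "((\<lambda>t. c (t + 2 * pi)) has_vector_derivative T (t + 2 * pi)) (at t)"
      by (rule has_vector_derivative_shift[OF c])
    then show ?thesis using c[of t] unfolding per by (rule vector_derivative_unique_at)
  qed
  have nper: "n (t + 2 * pi) = n t" for t by (simp add: n_def Tper)
  have "\<exists>k::int. \<phi> (t + 2 * pi) = \<phi> t + 2 * pi * k" for t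
    using T1[of "t + 2 * pi"] T2[of "t + 2 * pi"] T1[of t] T2[of t] npos[of t]
    by (intro sin_cos_eq_iff[THEN iffD1]) (simp add: Tper nper)
  \<comment> \<open>The tangent closes up, so \<open>\<phi>\<close> gains a positive multiple \<open>2\<pi>k\<close> of the full turn over a period. If \<open>k\<close>\<close>
  \<comment> \<open>were larger than 1, one normal direction would occur twice within a period, and uniqueness of the\<close>
  \<comment> \<open>support point would contradict injectivity of the curve.\<close>
  then obtain k :: int where k: "\<phi> (0 + 2 * pi) = \<phi> 0 + 2 * pi * k" by blast
  have "0 < k" using mono[of 0 "0 + 2 * pi"] k by (simp add: zero_less_mult_iff)
  have "k = 1"
  proof (rule ccontr)
    assume "k \<noteq> 1"
    with \<open>0 < k\<close> have "2 \<le> real_of_int k" by linarith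
    then have le: "\<phi> 0 + 2 * pi < \<phi> (2 * pi)" using k by simp
    have "\<exists>t\<ge>0. t \<le> 2 * pi \<and> \<phi> t = \<phi> 0 + 2 * pi"
      using le by (intro IVT) (auto intro: DERIV_isCont[OF \<phi>])
    then obtain t where t: "0 \<le> t" "t \<le> 2 * pi" "\<phi> t = \<phi> 0 + 2 * pi" by blast
    have "t \<noteq> 0" "t \<noteq> 2 * pi" using t(3) le by auto
    have "c t = c 0" using t(3) by (intro unique) (simp add: direction_periodic)
    then obtain j :: int where j: "t = 2 * pi * j" using inj[of t 0] by auto
    have "0 < t" "t < 2 * pi" using t \<open>t \<noteq> 0\<close> \<open>t \<noteq> 2 * pi\<close> by auto
    then have "0 < real_of_int j" "real_of_int j < 1"
      unfolding j by (simp_all add: zero_less_mult_iff mult_less_cancel_left2)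
    then show False by simp
  qed
  have quasi: "\<phi> (t + 2 * pi) = \<phi> t + 2 * pi" for t
  proof -
    have \<kappa>per: "\<kappa> (t + 2 * pi) = \<kappa> t" for t
    proof -
      have "((\<lambda>t. T (t + 2 * pi)) has_vector_derivative T2 (t + 2 * pi)) (at t)"
        by (rule has_vector_derivative_shift[OF T])
      then have "T2 (t + 2 * pi) = T2 t" using T[of t] unfolding Tper by (rule vector_derivative_unique_at)
      then show ?thesis by (simp add: \<kappa>_def Tper)
    qed
    have "((\<lambda>t. \<phi> (t + 2 * pi) - \<phi> t) has_real_derivative 0) (at t)" for t
    proof -
      have "((\<lambda>t. \<phi> (t + 2 * pi)) has_real_derivative \<kappa> (t + 2 * pi)) (at t)"
        using \<phi>[of "t + 2 * pi"] by (simp only: DERIV_shift)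
      from DERIV_diff[OF this \<phi>[of t]] show ?thesis by (simp add: \<kappa>per)
    qed
    from equal_if_derivative_zero[of "\<lambda>t. \<phi> (t + 2 * pi) - \<phi> t" t 0, OF this]
    show ?thesis using k \<open>k = 1\<close> by simp
  qed
  have quasi_int: "\<phi> (t + 2 * pi * real_of_int j) = \<phi> t + 2 * pi * real_of_int j" for t j
    using periodic_of_int[of "\<lambda>t. \<phi> t - t" "2 * pi" t j] quasi by simp
  have "(0::real) < 2 * pi" by simp
  then obtain \<psi> where \<psi>: "\<And>\<theta>. \<phi> (\<psi> \<theta>) = \<theta>" "\<And>t. \<psi> (\<phi> t) = t"
    "\<And>\<theta>. (\<psi> has_real_derivative 1 / \<kappa> (\<psi> \<theta>)) (at \<theta>)"
    using quasiperiodic_inverse[OF \<phi> \<kappa>pos quasi] by blast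
  define \<rho> where "\<rho> = (\<lambda>\<theta>. n (\<psi> \<theta>) / \<kappa> (\<psi> \<theta>))"
  have \<rho>pos: "0 < \<rho> \<theta>" for \<theta> by (simp add: \<rho>_def npos \<kappa>pos)
  have cont\<psi>: "continuous_on UNIV \<psi>" using \<psi>(3) by (intro DERIV_continuous_on) auto
  have contn: "continuous_on UNIV n" unfolding n_def by (intro continuous_intros contT)
  have nz0: "\<forall>t\<in>UNIV. (T t $ 1)\<^sup>2 + (T t $ 2)\<^sup>2 \<noteq> 0" using nz by (metis less_irrefl)
  have cont\<kappa>: "continuous_on UNIV \<kappa>" unfolding \<kappa>_def
    by (intro continuous_on_divide nz0 continuous_intros contT contT2)
  have nz1: "\<forall>\<theta>\<in>UNIV. \<kappa> (\<psi> \<theta>) \<noteq> 0" using \<kappa>pos by (metis less_irrefl)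
  have cont\<rho>: "continuous_on UNIV \<rho>" unfolding \<rho>_def
    by (intro continuous_on_divide nz1 continuous_on_compose2[OF contn cont\<psi>] continuous_on_compose2[OF cont\<kappa> cont\<psi>]) simp_all
  have c\<psi>: "((\<lambda>\<theta>. c (\<psi> \<theta>) $ i) has_real_derivative T (\<psi> \<theta>) $ i * (1 / \<kappa> (\<psi> \<theta>))) (at \<theta>)" for i \<theta>
    by (rule DERIV_chain2[OF dc \<psi>(3)])
  have g1: "((\<lambda>\<theta>. c (\<psi> \<theta>) $ 1) has_real_derivative - (\<rho> \<theta> * sin \<theta>)) (at \<theta>)" for \<theta>
    using c\<psi>[of 1 \<theta>] by (simp add: T1 \<rho>_def \<psi>)
  have g2: "((\<lambda>\<theta>. c (\<psi> \<theta>) $ 2) has_real_derivative \<rho> \<theta> * cos \<theta>) (at \<theta>)" for \<theta>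
    using c\<psi>[of 2 \<theta>] by (simp add: T2 \<rho>_def \<psi>)
  have p_eq: "p = (\<lambda>\<theta>. c (\<psi> \<theta>) $ 1 * cos \<theta> + c (\<psi> \<theta>) $ 2 * sin \<theta>)"
    using p\<phi>[of "\<psi> _"] by (auto simp: \<psi> inner_direction)
  define p' where "p' = (\<lambda>\<theta>. c (\<psi> \<theta>) $ 2 * cos \<theta> - c (\<psi> \<theta>) $ 1 * sin \<theta>)"
  have dp: "(p has_real_derivative p' \<theta>) (at \<theta>)" for \<theta>
    unfolding p_eq p'_def
    by (rule derivative_eq_intros g1 g2 refl)+ (simp add: algebra_simps)
  have dp': "(p' has_real_derivative \<rho> \<theta> - p \<theta>) (at \<theta>)" for \<theta>
  proof -
    have "\<rho> \<theta> * (cos \<theta> * cos \<theta>) + \<rho> \<theta> * (sin \<theta> * sin \<theta>) = \<rho> \<theta>"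
      using sin_cos_squared_add3[of \<theta>] by (metis distrib_left mult.right_neutral)
    then have e: "- (\<rho> \<theta> * sin \<theta> * sin \<theta>) = \<rho> \<theta> * cos \<theta> * cos \<theta> - \<rho> \<theta>"
      by (simp add: mult.assoc)
    show ?thesis unfolding p_eq p'_def
      by (rule derivative_eq_intros g1 g2 refl)+ (use e in \<open>simp add: algebra_simps\<close>)
  qed
  have contp: "continuous_on UNIV p" using dp by (intro DERIV_continuous_on) auto
  have param: "support_param (frontier K) \<theta> = c (\<psi> \<theta>)" for \<theta>
  proof -
    have d: "deriv p \<theta> = p' \<theta>" using dp by (rule DERIV_imp_deriv)
    have 1: "p \<theta> * cos \<theta> - p' \<theta> * sin \<theta> = c (\<psi> \<theta>) $ 1"
      and 2: "p \<theta> * sin \<theta> + p' \<theta> * cos \<theta> = c (\<psi> \<theta>) $ 2"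
      unfolding p_eq p'_def by (rule coordinates_in_rotated_frame)+
    show ?thesis
      unfolding support_param_def p_def[symmetric] d 1 2 by (simp add: vec_eq_iff forall_2)
  qed
  have len: "integral {0..2 * pi} p = integral {0..2 * pi} (\<lambda>t. norm (T t))"
  proof -
    \<comment> \<open>\<open>P + p'\<close> is an antiderivative of the radius of curvature, that is, an arc length.\<close>
    obtain P where P: "\<And>\<theta>. (P has_real_derivative p \<theta>) (at \<theta>)"
      using exists_antiderivative[OF contp] by blast
    have "((\<lambda>t. P (\<phi> t) + p' (\<phi> t)) has_real_derivative n t) (at t)" for t
    proof -
      have "((\<lambda>t. P (\<phi> t) + p' (\<phi> t)) has_real_derivative p (\<phi> t) * \<kappa> t + (\<rho> (\<phi> t) - p (\<phi> t)) * \<kappa> t) (at t)"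
        by (intro DERIV_add DERIV_chain2[OF P \<phi>] DERIV_chain2[OF dp' \<phi>])
      then show ?thesis using \<kappa>pos[of t] by (simp add: \<rho>_def \<psi> algebra_simps)
    qed
    note deriv_n = this
    have "p' (\<phi> (0 + 2 * pi)) = p' (\<phi> 0)"
      unfolding p'_def \<psi>(2) per[of 0] unfolding quasi[of 0] by simp
    then have p'per: "p' (\<phi> 0 + 2 * pi) = p' (\<phi> 0)"
      unfolding quasi[of 0] .
    from has_integral_of_derivative[OF deriv_n, of 0 "2 * pi"]
    have "integral {0..2 * pi} n = P (\<phi> 0 + 2 * pi) - P (\<phi> 0) + (p' (\<phi> 0 + 2 * pi) - p' (\<phi> 0))"
      using quasi[of 0] by (simp add: integral_unique)
    also note p'per
    also have "P (\<phi> 0 + 2 * pi) - P (\<phi> 0) = integral {\<phi> 0..\<phi> 0 + 2 * pi} p"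
      using has_integral_of_derivative[OF P, of "\<phi> 0" "\<phi> 0 + 2 * pi"] by (simp add: integral_unique)
    also have "\<dots> = integral {0..0 + 2 * pi} p"
    proof (rule integral_over_period[OF contp])
      show "p (\<theta> + 2 * pi) = p \<theta>" for \<theta>
        by (simp add: p_def support_fn_def direction_periodic)
    qed simp
    finally show ?thesis by (simp add: normT)
  qed
  show ?thesis
  proof (rule that[of p' "\<lambda>\<theta>. \<rho> \<theta> - p \<theta>"])
    show "range (support_param (frontier K)) = frontier K"
    proof -
      have eq: "support_param (frontier K) = (\<lambda>\<theta>. c (\<psi> \<theta>))" using param by auto
      have "range \<psi> = UNIV" using \<psi>(2) by (metis surjI)
      then show ?thesis unfolding eq using M by (metis image_image)
    qed
    show "\<exists>k::int. s = t + 2 * pi * k"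
      if eq: "support_param (frontier K) s = support_param (frontier K) t" for s t
    proof -
      obtain k :: int where k: "\<psi> s = \<psi> t + 2 * pi * k" using inj eq unfolding param by blast
      then have "s = t + 2 * pi * k" using quasi_int[of "\<psi> t" k] \<psi>(1) by metis
      then show ?thesis by blast
    qed
  qed (use dp dp' \<rho>pos len contp cont\<rho> in \<open>auto intro!: continuous_intros simp: p_def\<close>)
qed

lemma has_vector_derivative_reflect:
  assumes "(f has_vector_derivative D) (at (- t))"
  shows "((\<lambda>t. f (- t)) has_vector_derivative - D) (at t)"
proof -
  have "(uminus has_vector_derivative (- 1::real)) (at t)"
    unfolding has_real_derivative_iff_has_vector_derivative[symmetric] by (auto intro!: derivative_eq_intros)
  from vector_diff_chain_at[OF this assms] show ?thesis by (simp add: o_def)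
qed

text \<open>
A parametrization with negative curvature is reversed first; this preserves the point set and the length.
\<close>
lemma support_of_oval:
  assumes K: "strictly_convex_domain K" and oval: "oval_param c" "c ` {0..2 * pi} = frontier K"
  obtains p' p'' where
    "\<And>\<theta>. (support_fn (frontier K) has_real_derivative p' \<theta>) (at \<theta>)"
    "\<And>\<theta>. (p' has_real_derivative p'' \<theta>) (at \<theta>)"
    "continuous_on UNIV p''"
    "\<And>\<theta>. 0 < support_fn (frontier K) \<theta> + p'' \<theta>"
    "integral {0..2 * pi} (support_fn (frontier K)) = curve_length c"
    "range (support_param (frontier K)) = frontier K"
    "\<And>s t. support_param (frontier K) s = support_param (frontier K) t \<Longrightarrow> \<exists>k::int. s = t + 2 * pi * k"
proof -
  define T where "T = vderiv c"
  define T2 where "T2 = vderiv T"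
  have smooth: "(vderiv ^^ k) c differentiable at t" for k t
    using oval(1) by (simp add: oval_param_def smooth_curve_def)
  have c: "(c has_vector_derivative T t) (at t)" for t
    using smooth[of 0 t] by (simp add: T_def vderiv_def vector_derivative_works)
  have T: "(T has_vector_derivative T2 t) (at t)" for t
    using smooth[of 1 t] by (simp add: T_def T2_def vderiv_def vector_derivative_works)
  have "T2 differentiable at t" for t
    using smooth[of 2 t] by (simp add: T_def T2_def numeral_2_eq_2)
  then have contT2: "continuous_on UNIV T2"
    by (simp add: continuous_on_eq_continuous_at differentiable_imp_continuous_within)
  have contT: "continuous_on UNIV T"
    using T by (meson continuous_at_imp_continuous_on has_vector_derivative_continuous)
  have per: "c (t + 2 * pi) = c t" for t
    using oval(1) by (simp add: oval_param_def)
  have Tper: "T (t + 2 * pi) = T t" for t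
  proof -
    have "((\<lambda>t. c (t + 2 * pi)) has_vector_derivative T (t + 2 * pi)) (at t)"
      by (rule has_vector_derivative_shift[OF c])
    then show ?thesis using c[of t] unfolding per by (rule vector_derivative_unique_at)
  qed
  have pos: "(0::real) < 2 * pi" by simp
  have inj: "\<exists>k::int. s = t + 2 * pi * k" if "c s = c t" for s t
  proof -
    obtain i :: int where i: "s + 2 * pi * i \<in> {0..<2 * pi}" using reduce_modulo_period[OF pos] .
    obtain j :: int where j: "t + 2 * pi * j \<in> {0..<2 * pi}" using reduce_modulo_period[OF pos] .
    have "c (s + 2 * pi * i) = c (t + 2 * pi * j)"
      using periodic_of_int[of c "2 * pi" s i, OF per] periodic_of_int[of c "2 * pi" t j, OF per] that by simp
    moreover have "inj_on c {0..<2 * pi}" using oval(1) by (simp add: oval_param_def)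
    ultimately have "s + 2 * pi * i = t + 2 * pi * j" using i j by (meson inj_onD)
    then have "s = t + 2 * pi * of_int (j - i)" by (simp add: algebra_simps)
    then show ?thesis by blast
  qed
  have M: "range c = frontier K"
  proof -
    have "c t \<in> c ` {0..2 * pi}" for t
    proof -
      obtain i :: int where i: "t + 2 * pi * i \<in> {0..<2 * pi}" using reduce_modulo_period[OF pos] .
      then show ?thesis
        using periodic_of_int[of c "2 * pi" t i, OF per] by (intro image_eqI[of _ _ "t + 2 * pi * i"]) auto
    qed
    then show ?thesis using oval(2) by blast
  qed
  have side: "(\<forall>s. 0 \<le> cross2 (T t) (c s - c t)) \<or> (\<forall>s. cross2 (T t) (c s - c t) \<le> 0)" for t
    using oval(1) by (simp add: oval_param_def T_def)
  have nz: "T t \<noteq> 0" for t using oval(1) by (simp add: oval_param_def T_def)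
  have len: "curve_length c = integral {0..2 * pi} (\<lambda>t. norm (T t))"
    by (simp add: curve_length_def T_def)
  consider "\<forall>t. 0 < signed_curvature c t" | "\<forall>t. signed_curvature c t < 0"
    using oval(1) by (auto simp: oval_param_def)
  then show ?thesis
  proof cases
    case 1
    then have "0 < cross2 (T t) (T2 t)" for t
      using nz[of t] by (simp add: signed_curvature_def T_def T2_def zero_less_divide_iff)
    from support_of_positive_curve[OF K c T contT2 M per inj side this] that len show ?thesis
      by metis
  next
    case 2
    then have curv: "0 < cross2 (- T (- t)) (T2 (- t))" for t
      using nz[of "- t"] by (simp add: signed_curvature_def T_def T2_def divide_less_0_iff cross2_def)
    have c': "((\<lambda>t. c (- t)) has_vector_derivative - T (- t)) (at t)" for t
      by (rule has_vector_derivative_reflect[OF c])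
    have T': "((\<lambda>t. - T (- t)) has_vector_derivative T2 (- t)) (at t)" for t
      using has_vector_derivative_minus[OF has_vector_derivative_reflect[OF T, of t]] by simp
    have cont': "continuous_on UNIV (\<lambda>t. T2 (- t))"
      by (intro continuous_on_compose2[OF contT2] continuous_intros) auto
    have "range (\<lambda>t. c (- t)) = range c"
      by (metis image_image surj_uminus)
    then have M': "range (\<lambda>t. c (- t)) = frontier K" using M by simp
    have per': "c (- (t + 2 * pi)) = c (- t)" for t
      using per[of "- t - 2 * pi"] by simp
    have inj': "\<exists>k::int. s = t + 2 * pi * k" if eq: "c (- s) = c (- t)" for s t
    proof -
      obtain k :: int where "- s = - t + 2 * pi * k" using inj[OF eq] by blast
      then have "s = t + 2 * pi * of_int (- k)" by simp
      then show ?thesis by blast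
    qed
    have side': "(\<forall>s. 0 \<le> cross2 (- T (- t)) (c (- s) - c (- t))) \<or> (\<forall>s. cross2 (- T (- t)) (c (- s) - c (- t)) \<le> 0)" for t
      using side[of "- t"] by (auto simp: cross2_def)
    have "integral {0..2 * pi} (\<lambda>t. norm (- T (- t))) = integral {- (2 * pi)..- 0} (\<lambda>t. norm (T t))"
      using Henstock_Kurzweil_Integration.integral_reflect_real[of 0 "- (2 * pi)" "\<lambda>t. norm (T t)"] by simp
    also have "\<dots> = integral {- (2 * pi)..- (2 * pi) + 2 * pi} (\<lambda>t. norm (T t))" by simp
    also have "\<dots> = integral {0..0 + 2 * pi} (\<lambda>t. norm (T t))"
      by (rule integral_over_period) (auto intro!: continuous_intros contT simp: Tper)
    finally have "integral {0..2 * pi} (\<lambda>t. norm (- T (- t))) = curve_length c" by (simp add: len)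
    with support_of_positive_curve[OF K c' T' cont' M' per' inj' side' curv] that show ?thesis
      by metis
  qed
qed

section \<open>Area in terms of the support function\<close>
lemma content_box_2:
  assumes "a1 \<le> b1" "a2 \<le> b2"
  shows "measure lebesgue {v :: real^2. a1 < v $ 1 \<and> v $ 1 < b1 \<and> a2 < v $ 2 \<and> v $ 2 < b2}
      = (b1 - a1) * (b2 - a2)"
proof -
  have "{v :: real^2. a1 < v $ 1 \<and> v $ 1 < b1 \<and> a2 < v $ 2 \<and> v $ 2 < b2} = box (vector [a1, a2]) (vector [b1, b2])"
    by (auto simp: mem_box_cart forall_2)
  moreover have "cbox (vector [a1, a2]) (vector [b1, b2] :: real^2) \<noteq> {}"
    using assms by (auto simp: interval_ne_empty_cart forall_2)
  moreover have "measure lebesgue (box l u) = measure lborel (cbox l u)" for l u :: "real^2"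
    by (simp add: measure_lborel_box_eq measure_lborel_cbox_eq)
  ultimately show ?thesis
    by (simp add: content_cbox_cart UNIV_2)
qed

text \<open>
Green's formula for a curve around \<open>z\<close>. Let \<open>a(t)\<close> be twice the area swept by the segment from \<open>z\<close>, and \<open>b\<close>
its inverse. The map \<open>(x, y) \<mapsto> z + sqrt (2 x) (g (b y) - z)\<close> has Jacobian 1: the factor \<open>r = sqrt (2 x)\<close> of
polar coordinates is absorbed by \<open>dx = r dr\<close>, the factor \<open>(g - z) \<times> g'\<close> by \<open>dy = da\<close>. It maps an open
rectangle with sides \<open>1/2\<close> and \<open>C = \<integral> (g - z) \<times> g'\<close> injectively into \<open>K\<close> and misses only points of
the frontier and of the line through \<open>z\<close> and \<open>g 0\<close>, which form a null set. So the change of variables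
formula gives the area without any iterated integral.
\<close>
lemma area_of_starlike_curve:
  fixes g g' :: "real \<Rightarrow> real^2"
  assumes K: "strictly_convex_domain K" and z: "z \<in> interior K"
    and M: "range g = frontier K"
    and g: "\<And>t. (g has_vector_derivative g' t) (at t)" and cont: "continuous_on UNIV g'"
    and per: "\<And>t. g (t + 2 * pi) = g t"
    and inj: "\<And>s t. g s = g t \<Longrightarrow> \<exists>k::int. s = t + 2 * pi * k"
    and star: "\<And>t. 0 < cross2 (g t - z) (g' t)"
  shows "measure lebesgue K = (1/2) * integral {0..2 * pi} (\<lambda>t. cross2 (g t - z) (g' t))"
proof -
  have compK: "compact K" using K by (simp add: strictly_convex_domain_def)
  have seg: "open_segment x y \<subseteq> interior K" if "x \<in> K" "y \<in> K" "x \<noteq> y" for x y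
    using K that by (simp add: strictly_convex_domain_def)
  have zK: "z \<in> K" using z interior_subset by blast
  have frK: "frontier K \<subseteq> K" using compK by (simp add: compact_imp_closed frontier_subset_closed)
  have gK: "g t \<in> frontier K" for t using M by blast
  have fr_int: "x \<notin> interior K" if "x \<in> frontier K" for x using that by (simp add: frontier_def)
  have convK: "convex K"
    unfolding convex_contains_open_segment using seg interior_subset by (metis empty_subsetI open_segment_idem subset_trans)
  define k where "k = (\<lambda>t. cross2 (g t - z) (g' t))"
  have kpos: "0 < k t" for t using star by (simp add: k_def)
  have contg: "continuous_on UNIV g"
    using g by (meson continuous_at_imp_continuous_on has_vector_derivative_continuous)
  have contk: "continuous_on UNIV k"
    unfolding k_def cross2_def by (intro continuous_intros contg cont)
  have g'per: "g' (t + 2 * pi) = g' t" for t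
  proof -
    have "((\<lambda>t. g (t + 2 * pi)) has_vector_derivative g' (t + 2 * pi)) (at t)"
      by (rule has_vector_derivative_shift[OF g])
    then show ?thesis using g[of t] unfolding per by (rule vector_derivative_unique_at)
  qed
  have kper: "k (t + 2 * pi) = k t" for t by (simp add: k_def per g'per)
  obtain a where a: "\<And>t. (a has_real_derivative k t) (at t)"
    using exists_antiderivative[OF contk] by blast
  have a_mono: "a s < a t" if "s < t" for s t
    using DERIV_pos_imp_increasing[OF that, of a] a kpos by blast
  define C where "C = integral {0..2 * pi} k"
  have a_quasi: "a (t + 2 * pi) = a t + C" for t
  proof -
    have "a (t + 2 * pi) - a t = integral {t..t + 2 * pi} k"
      using has_integral_of_derivative[OF a, of t "t + 2 * pi"] by (simp add: integral_unique)
    also have "\<dots> = integral {0..0 + 2 * pi} k"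
      by (rule integral_over_period[OF contk]) (simp_all add: kper)
    finally show ?thesis by (simp add: C_def)
  qed
  have "(0::real) < 2 * pi" by simp
  then obtain b where b: "\<And>y. a (b y) = y" "\<And>t. b (a t) = t"
    "\<And>y. (b has_real_derivative 1 / k (b y)) (at y)"
    using quasiperiodic_inverse[OF a kpos a_quasi] by blast
  have "0 < C" using a_mono[of 0 "0 + 2 * pi"] a_quasi[of 0] by simp
  define S where "S = {v :: real^2. 0 < v $ 1 \<and> v $ 1 < 1/2 \<and> a 0 < v $ 2 \<and> v $ 2 < a 0 + C}"
  define F where "F = (\<lambda>v :: real^2. z + sqrt (2 * v $ 1) *\<^sub>R (g (b (v $ 2)) - z))"
  define F' where "F' = (\<lambda>(v :: real^2) (h :: real^2).
      sqrt (2 * v $ 1) *\<^sub>R (h $ 2 *\<^sub>R ((1 / k (b (v $ 2))) *\<^sub>R g' (b (v $ 2))))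
      + (h $ 1 * (1 / sqrt (2 * v $ 1))) *\<^sub>R (g (b (v $ 2)) - z))"
  have S_eq: "S = box (vector [0, a 0]) (vector [1/2, a 0 + C])"
    by (auto simp: S_def mem_box_cart forall_2)
  have F': "(F has_derivative F' v) (at v within S)" if "v \<in> S" for v
  proof -
    have v1: "0 < v $ 1" using that by (simp add: S_def)
    have 1: "((\<lambda>v :: real^2. v $ i) has_derivative (\<lambda>h. h $ i)) (at v within S)" for i
      by (intro bounded_linear_imp_has_derivative bounded_linear_vec_nth)
    have "((\<lambda>x. sqrt (2 * x)) has_real_derivative 1 / sqrt (2 * v $ 1)) (at (v $ 1))"
      using v1 by (auto intro!: derivative_eq_intros simp: inverse_eq_divide)
    from DERIV_compose_FDERIV[OF this 1]
    have 2: "((\<lambda>v :: real^2. sqrt (2 * v $ 1)) has_derivative (\<lambda>h. h $ 1 * (1 / sqrt (2 * v $ 1)))) (at v within S)" .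
    have "((g \<circ> b) has_vector_derivative (1 / k (b (v $ 2))) *\<^sub>R g' (b (v $ 2))) (at (v $ 2))"
      by (rule vector_diff_chain_at) (use b(3) g in \<open>auto simp: has_real_derivative_iff_has_vector_derivative\<close>)
    then have "((g \<circ> b) has_derivative (\<lambda>x. x *\<^sub>R ((1 / k (b (v $ 2))) *\<^sub>R g' (b (v $ 2))))) (at (v $ 2))"
      by (simp add: has_vector_derivative_def)
    from has_derivative_compose[OF 1 this]
    have 3: "((\<lambda>v :: real^2. g (b (v $ 2))) has_derivative (\<lambda>h. h $ 2 *\<^sub>R ((1 / k (b (v $ 2))) *\<^sub>R g' (b (v $ 2))))) (at v within S)"
      by (simp add: o_def)
    have 4: "((\<lambda>v :: real^2. g (b (v $ 2)) - z) has_derivative (\<lambda>h. h $ 2 *\<^sub>R ((1 / k (b (v $ 2))) *\<^sub>R g' (b (v $ 2))))) (at v within S)"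
      using has_derivative_diff[OF 3 has_derivative_const[of z]] by simp
    have "((\<lambda>v :: real^2. sqrt (2 * v $ 1) *\<^sub>R (g (b (v $ 2)) - z)) has_derivative F' v) (at v within S)"
      unfolding F'_def by (rule has_derivative_scaleR[OF 2 4])
    from has_derivative_add[OF has_derivative_const[of z] this]
    show ?thesis unfolding F_def by simp
  qed
  have detF': "det (matrix (F' v)) = 1" if "v \<in> S" for v
  proof -
    have v1: "0 < v $ 1" using that by (simp add: S_def)
    define r where "r = sqrt (2 * v $ 1)"
    define G where "G = g (b (v $ 2)) - z"
    define D where "D = g' (b (v $ 2))"
    define q where "q = k (b (v $ 2))"
    have rq: "0 < r" "0 < q" using v1 kpos by (simp_all add: r_def q_def)
    have q: "q = G $ 1 * D $ 2 - G $ 2 * D $ 1"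
      by (simp add: q_def k_def cross2_def G_def D_def)
    have "F' v = (\<lambda>h. r *\<^sub>R (h $ 2 *\<^sub>R ((1 / q) *\<^sub>R D)) + (h $ 1 * (1 / r)) *\<^sub>R G)"
      unfolding F'_def r_def G_def D_def q_def by simp
    then have "det (matrix (F' v)) = (1/r * G $ 1) * (r * (1/q * D $ 2)) - (r * (1/q * D $ 1)) * (1/r * G $ 2)"
      by (simp add: det_2 matrix_def axis_def)
    also have "\<dots> = (G $ 1 * D $ 2 - G $ 2 * D $ 1) / q"
      using rq by (simp add: field_simps)
    also have "\<dots> = 1" using rq q by simp
    finally show ?thesis .
  qed
  \<comment> \<open>A ray from \<open>z\<close> meets the frontier only once, since otherwise the nearer point would be interior to \<open>K\<close>\<close>
  \<comment> \<open>by strict convexity.\<close>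
  have same_ray: "g s = g t \<and> r = r'"
    if r: "0 < r" "0 < r'" and eq: "r *\<^sub>R (g s - z) = r' *\<^sub>R (g t - z)" for r r' s t
  proof -
    have ne: "g s \<noteq> z" for s using fr_int[OF gK] z by metis
    have le: "\<not> r < r'" if r: "0 < r" "0 < r'" and eq: "r *\<^sub>R (g s - z) = r' *\<^sub>R (g t - z)" for r r' s t
    proof
      assume "r < r'"
      have "g t - z = (r / r') *\<^sub>R (g s - z)"
      proof -
        have "r' *\<^sub>R (g t - z) = r' *\<^sub>R ((r / r') *\<^sub>R (g s - z))"
          using eq r by (simp add: scaleR_scaleR)
        then show ?thesis using r by (simp only: scaleR_cancel_left) auto
      qed
      then have "g t = (1 - r / r') *\<^sub>R z + (r / r') *\<^sub>R g s" by (simp add: algebra_simps)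
      then have "g t \<in> open_segment z (g s)"
        unfolding in_segment using \<open>r < r'\<close> r ne[of s] by (auto intro!: exI[of _ "r / r'"])
      then have "g t \<in> interior K" using seg[OF zK _ ne[symmetric]] gK frK by blast
      then show False using fr_int[OF gK] by blast
    qed
    have "r = r'" using le[OF r eq] le[OF r(2) r(1) eq[symmetric]] by simp
    with eq r show ?thesis by simp
  qed
  have inj_ab: "s = t" if eq: "g s = g t" and "0 < s" "s < 2 * pi" "0 < t" "t < 2 * pi" for s t
  proof -
    obtain k :: int where k: "s = t + 2 * pi * k" using inj[OF eq] by blast
    have "2 * pi * real_of_int k < 2 * pi * 1" "2 * pi * (- 1) < 2 * pi * real_of_int k"
      using k that by linarith+
    then have "real_of_int k < 1" "- 1 < real_of_int k"
      by (simp_all only: mult_less_cancel_left_pos[OF \<open>0 < 2 * pi\<close>])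
    then have "k = 0" by linarith
    then show ?thesis using k by simp
  qed
  have b_range: "0 < b y \<and> b y < 2 * pi" if "a 0 < y" "y < a 0 + C" for y
  proof -
    have "\<not> b y \<le> 0" using a_mono[of "b y" 0] b(1)[of y] that by (cases "b y = 0") auto
    moreover have "\<not> 2 * pi \<le> b y"
      using a_mono[of "2 * pi" "b y"] b(1)[of y] that a_quasi[of 0] by (cases "b y = 2 * pi") auto
    ultimately show ?thesis by simp
  qed
  have injF: "inj_on F S"
  proof (rule inj_onI)
    fix v w assume v: "v \<in> S" and w: "w \<in> S" and eq: "F v = F w"
    have "sqrt (2 * v $ 1) *\<^sub>R (g (b (v $ 2)) - z) = sqrt (2 * w $ 1) *\<^sub>R (g (b (w $ 2)) - z)"
      using eq by (simp add: F_def)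
    from same_ray[OF _ _ this] v w
    have "g (b (v $ 2)) = g (b (w $ 2))" "sqrt (2 * v $ 1) = sqrt (2 * w $ 1)"
      by (auto simp: S_def)
    moreover from this(1) have "b (v $ 2) = b (w $ 2)"
      by (rule inj_ab) (use b_range v w in \<open>auto simp: S_def\<close>)
    then have "v $ 2 = w $ 2" using b(1) by metis
    ultimately show "v = w" by (simp add: vec_eq_iff forall_2)
  qed
  have meas_int: "(\<lambda>v. \<bar>det (matrix (F' v))\<bar>) integrable_on S \<longleftrightarrow> (\<lambda>v. 1::real) integrable_on S"
    by (rule integrable_cong) (simp add: detF')
  have S_lm: "S \<in> lmeasurable" unfolding S_eq by simp
  have S_leb: "S \<in> sets lebesgue" using S_lm by (simp add: fmeasurableD)
  have int1: "(\<lambda>v. \<bar>det (matrix (F' v))\<bar>) integrable_on S"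
    unfolding meas_int using S_lm by (simp add: lmeasurable_iff_integrable_on)
  have "measure lebesgue (F ` S) = integral S (\<lambda>v. \<bar>det (matrix (F' v))\<bar>)"
    by (rule measure_differentiable_image_eq[OF S_leb F' injF int1])
  also have "\<dots> = integral S (\<lambda>v. 1)"
    by (rule integral_cong) (simp add: detF')
  also have "\<dots> = measure lebesgue S" by (simp add: lmeasure_integral S_lm)
  also have "\<dots> = C / 2" unfolding S_def using content_box_2[of 0 "1/2" "a 0" "a 0 + C"] \<open>0 < C\<close> by simp
  finally have FS: "measure lebesgue (F ` S) = C / 2" .
  have FS_lm: "F ` S \<in> lmeasurable"
    using measurable_differentiable_image_eq[OF S_leb F' injF] int1 by blast
  have sub: "F ` S \<subseteq> K"
  proof clarify
    fix v assume v: "v \<in> S"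
    have "0 \<le> sqrt (2 * v $ 1)" "sqrt (2 * v $ 1) \<le> 1" using v by (simp_all add: S_def)
    moreover have "F v = (1 - sqrt (2 * v $ 1)) *\<^sub>R z + sqrt (2 * v $ 1) *\<^sub>R g (b (v $ 2))"
      by (simp add: F_def algebra_simps)
    moreover have "g (b (v $ 2)) \<in> K" using gK frK by blast
    ultimately show "F v \<in> K" by (simp only: convexD_alt[OF convK zK])
  qed
  define R where "R = (\<lambda>x. z + x) ` span {g 0 - z}"
  have negR: "negligible R"
  proof -
    have "dim (span {g 0 - z}) \<le> 1" using dim_le_card'[of "{g 0 - z}"] by (simp add: dim_span)
    then have "negligible (span {g 0 - z})" by (intro negligible_lowdim) simp
    then show ?thesis unfolding R_def by (rule negligible_translation)
  qed
  have cover: "K \<subseteq> F ` S \<union> (frontier K \<union> R)"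
  proof
    fix x assume "x \<in> K"
    show "x \<in> F ` S \<union> (frontier K \<union> R)"
    proof (cases "x \<in> frontier K \<or> x = z")
      case True
      then show ?thesis by (auto simp: R_def span_zero intro: image_eqI[of _ _ 0])
    next
      case False
      then have xi: "x \<in> interior K" and xz: "x - z \<noteq> 0"
        using \<open>x \<in> K\<close> closure_subset by (auto simp: frontier_def)
      obtain d where d: "0 < d" "z + d *\<^sub>R (x - z) \<in> frontier K"
        "\<And>e. 0 \<le> e \<Longrightarrow> e < d \<Longrightarrow> z + e *\<^sub>R (x - z) \<in> interior K"
        using ray_to_frontier[OF compact_imp_bounded[OF compK] z xz] by metis
      have "1 < d"
      proof (rule ccontr)
        assume "\<not> 1 < d"
        then have "(1 - d) *\<^sub>R z + d *\<^sub>R x \<in> interior K"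
          using convexD_alt[OF convex_interior[OF convK] z xi, of d] d(1) by simp
        moreover have "(1 - d) *\<^sub>R z + d *\<^sub>R x = z + d *\<^sub>R (x - z)" by (simp add: algebra_simps)
        ultimately show False using fr_int[OF d(2)] by simp
      qed
      obtain t0 where t0: "g t0 = z + d *\<^sub>R (x - z)" using M d(2) by (metis rangeE)
      obtain j :: int where j: "t0 + 2 * pi * j \<in> {0..<2 * pi}" using reduce_modulo_period[OF \<open>0 < 2 * pi\<close>] .
      define t where "t = t0 + 2 * pi * j"
      have gt: "g t = z + d *\<^sub>R (x - z)"
        unfolding t_def using periodic_of_int[of g "2 * pi" t0 j, OF per] t0 by simp
      have x: "x = z + (1 / d) *\<^sub>R (g t - z)" using d(1) by (simp add: gt)
      show ?thesis
      proof (cases "t = 0")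
        case True
        have "(1 / d) *\<^sub>R (g 0 - z) \<in> span {g 0 - z}" by (intro span_mul span_base) simp
        with x True have "x \<in> R" unfolding R_def by blast
        then show ?thesis by blast
      next
        case False
        then have t: "0 < t" "t < 2 * pi" using j by (auto simp: t_def)
        define v :: "real^2" where "v = vector [1 / (2 * d\<^sup>2), a t]"
        have v: "v $ 1 = 1 / (2 * d\<^sup>2)" "v $ 2 = a t" by (simp_all add: v_def)
        have "sqrt (2 * v $ 1) = 1 / d"
          using d(1) by (simp add: v real_sqrt_divide)
        then have "F v = x" unfolding F_def x v(2) b(2) by simp
        moreover have "1 < d\<^sup>2" using \<open>1 < d\<close> by (simp add: power2_eq_square less_1_mult)
        then have "0 < 1 / (2 * d\<^sup>2)" "1 / (2 * d\<^sup>2) < 1 / 2"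
          using d(1) by (simp_all add: field_split_simps)
        then have "v \<in> S"
          using a_mono[OF t(1)] a_mono[OF t(2)] a_quasi[of 0] by (simp add: S_def v)
        ultimately show ?thesis by blast
      qed
    qed
  qed
  have "measure lebesgue K = measure lebesgue (F ` S)"
  proof (rule measure_negligible_symdiff[OF FS_lm])
    have "F ` S - K \<union> (K - F ` S) \<subseteq> frontier K \<union> R" using sub cover by blast
    moreover have "negligible (frontier K \<union> R)"
      using negligible_convex_frontier[OF convK] negR by (rule negligible_Un)
    ultimately show "negligible (F ` S - K \<union> (K - F ` S))" by (rule negligible_subset[rotated])
  qed
  then show ?thesis by (simp add: FS C_def k_def)
qed

text \<open>
The curve is \<open>q u + q' u'\<close>, the envelope of the lines \<open>x \<bullet> u(t) = q(t)\<close>. It covers both \<open>support_param\<close> and the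
CWMS, for which \<open>q\<close> is not the support function of a convex set.
\<close>
lemma support_curve_derivative:
  fixes q q' q'' :: "real \<Rightarrow> real"
  assumes "\<And>t. (q has_real_derivative q' t) (at t)" "\<And>t. (q' has_real_derivative q'' t) (at t)"
  shows "((\<lambda>t. vector [q t * cos t - q' t * sin t, q t * sin t + q' t * cos t] :: real^2)
    has_vector_derivative (q t + q'' t) *\<^sub>R vector [- sin t, cos t]) (at t)"
proof -
  have 1: "((\<lambda>t. q t * cos t - q' t * sin t) has_real_derivative - ((q t + q'' t) * sin t)) (at t)"
    by (rule derivative_eq_intros assms refl)+ (simp add: algebra_simps)
  have 2: "((\<lambda>t. q t * sin t + q' t * cos t) has_real_derivative (q t + q'' t) * cos t) (at t)"
    by (rule derivative_eq_intros assms refl)+ (simp add: algebra_simps)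
  have "((\<lambda>t. (q t * cos t - q' t * sin t) *\<^sub>R vector [1, 0] + (q t * sin t + q' t * cos t) *\<^sub>R vector [0, 1] :: real^2)
    has_vector_derivative (- ((q t + q'' t) * sin t)) *\<^sub>R vector [1, 0] + ((q t + q'' t) * cos t) *\<^sub>R vector [0, 1]) (at t)"
    using has_vector_derivative_add[OF has_vector_derivative_scaleR[OF 1 has_vector_derivative_const[of "vector [1, 0]"]]
        has_vector_derivative_scaleR[OF 2 has_vector_derivative_const[of "vector [0, 1]"]]] by simp
  moreover have "(- ((q t + q'' t) * sin t)) *\<^sub>R vector [1, 0] + ((q t + q'' t) * cos t) *\<^sub>R vector [0, 1]
     = (q t + q'' t) *\<^sub>R (vector [- sin t, cos t] :: real^2)"
    by (simp add: vec_eq_iff forall_2)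
  moreover have "(\<lambda>t. (q t * cos t - q' t * sin t) *\<^sub>R vector [1, 0] + (q t * sin t + q' t * cos t) *\<^sub>R vector [0, 1])
     = (\<lambda>t. vector [q t * cos t - q' t * sin t, q t * sin t + q' t * cos t] :: real^2)"
    by (rule ext) (simp add: vec_eq_iff forall_2)
  ultimately show ?thesis by (simp only:)
qed

text \<open>
The integrand of the oriented area is \<open>q (q + q'')\<close>, which differs from \<open>q\<^sup>2 - q'\<^sup>2\<close> by the derivative of the
periodic function \<open>q q'\<close>. The integral over two periods absorbs the factor \<open>1/2\<close>.
\<close>
lemma oriented_area_support_curve:
  fixes q q' q'' :: "real \<Rightarrow> real"
  assumes q: "\<And>t. (q has_real_derivative q' t) (at t)" "\<And>t. (q' has_real_derivative q'' t) (at t)"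
    and cont: "continuous_on UNIV q''" and per: "\<And>t. q (t + pi) = q t" "\<And>t. q' (t + pi) = q' t"
  shows "oriented_area (\<lambda>t. vector [q t * cos t - q' t * sin t, q t * sin t + q' t * cos t])
      = integral {0..pi} (\<lambda>t. (q t)\<^sup>2 - (q' t)\<^sup>2)"
proof -
  have contq: "continuous_on UNIV q" "continuous_on UNIV q'"
    using q by (auto intro!: DERIV_continuous_on)
  have d: "vderiv (\<lambda>t. vector [q t * cos t - q' t * sin t, q t * sin t + q' t * cos t]) t
      = (q t + q'' t) *\<^sub>R vector [- sin t, cos t]" for t
    unfolding vderiv_def by (rule vector_derivative_at[OF support_curve_derivative[OF q]])
  have e: "- (q t * sin t + q' t * cos t) * ((q t + q'' t) * - sin t) + (q t * cos t - q' t * sin t) * ((q t + q'' t) * cos t)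
      = (q t)\<^sup>2 + q t * q'' t" for t
  proof -
    have "- (q t * sin t + q' t * cos t) * ((q t + q'' t) * - sin t) + (q t * cos t - q' t * sin t) * ((q t + q'' t) * cos t)
      = (q t + q'' t) * q t * (cos t * cos t + sin t * sin t)"
      by algebra
    then show ?thesis unfolding sin_cos_squared_add3 by (simp add: power2_eq_square algebra_simps)
  qed
  have i1: "((\<lambda>t. (q t)\<^sup>2 + q t * q'' t) has_integral integral {0..2 * pi} (\<lambda>t. (q t)\<^sup>2 + q t * q'' t)) {0..2 * pi}"
    by (intro integrable_integral integrable_on_interval continuous_intros contq cont)
  have "((\<lambda>t. q t * q' t) has_real_derivative (q' t)\<^sup>2 + q t * q'' t) (at t)" for t
    by (rule derivative_eq_intros q refl)+ (simp add: power2_eq_square)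
  from has_integral_of_derivative[OF this, of 0 "2 * pi"]
  have i2: "((\<lambda>t. (q' t)\<^sup>2 + q t * q'' t) has_integral 0) {0..2 * pi}"
    using per(1)[of 0] per(1)[of pi] per(2)[of 0] per(2)[of pi] by simp
  have "((\<lambda>t. (q t)\<^sup>2 - (q' t)\<^sup>2) has_integral integral {0..2 * pi} (\<lambda>t. (q t)\<^sup>2 + q t * q'' t)) {0..2 * pi}"
    using has_integral_diff[OF i1 i2] by simp
  then have "integral {0..2 * pi} (\<lambda>t. (q t)\<^sup>2 + q t * q'' t) = integral {0..2 * pi} (\<lambda>t. (q t)\<^sup>2 - (q' t)\<^sup>2)"
    by (simp add: integral_unique)
  also have "\<dots> = integral {0..pi} (\<lambda>t. 2 * ((q t)\<^sup>2 - (q' t)\<^sup>2))"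
    using integral_two_halves[of "\<lambda>t. (q t)\<^sup>2 - (q' t)\<^sup>2"] by (simp add: continuous_intros contq per)
  finally have I: "integral {0..2 * pi} (\<lambda>t. (q t)\<^sup>2 + q t * q'' t) = 2 * integral {0..pi} (\<lambda>t. (q t)\<^sup>2 - (q' t)\<^sup>2)"
    by (simp only: integral_mult_right)
  have "oriented_area (\<lambda>t. vector [q t * cos t - q' t * sin t, q t * sin t + q' t * cos t])
      = 1/2 * integral {0..2 * pi} (\<lambda>t. (q t)\<^sup>2 + q t * q'' t)"
    unfolding oriented_area_def d
    by (simp only: vector_2 vector_scaleR_component real_scaleR_def e)
  then show ?thesis by (simp add: I)
qed

section \<open>The deficit and the Steiner symmetral\<close>
lemma integral_trig_cos: "integral {0..pi} (\<lambda>t. (\<alpha> * cos t + \<beta> * sin t) * cos t) = \<alpha> * pi / 2"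
proof -
  have "((\<lambda>t. (\<alpha> / 2) * (t + sin t * cos t) + (\<beta> / 2) * (sin t)\<^sup>2) has_real_derivative (\<alpha> * cos t + \<beta> * sin t) * cos t) (at t)" for t
    by (rule derivative_eq_intros refl)+ (simp add: power2_eq_square[symmetric] sin_squared_eq, simp add: algebra_simps power2_eq_square)
  from has_integral_of_derivative[OF this, of 0 pi] show ?thesis by (simp add: integral_unique)
qed

lemma integral_trig_sin: "integral {0..pi} (\<lambda>t. (\<alpha> * cos t + \<beta> * sin t) * sin t) = \<beta> * pi / 2"
proof -
  have "((\<lambda>t. (\<beta> / 2) * (t - sin t * cos t) + (\<alpha> / 2) * (sin t)\<^sup>2) has_real_derivative (\<alpha> * cos t + \<beta> * sin t) * sin t) (at t)" for t
    by (rule derivative_eq_intros refl)+ (simp add: power2_eq_square[symmetric] cos_squared_eq, simp add: algebra_simps power2_eq_square)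
  from has_integral_of_derivative[OF this, of 0 pi] show ?thesis by (simp add: integral_unique)
qed

text \<open>
Fold all integrals to \<open>[0, \<pi>]\<close> and write \<open>a = p(t)\<close>, \<open>b = p(t + \<pi>)\<close>. The square \<open>L\<^sup>2\<close> is cancelled by the constant
in \<open>q\<close>, and \<open>(a + b)\<^sup>2 - 2 a\<^sup>2 - 2 b\<^sup>2 = - (a - b)\<^sup>2\<close> leaves only the odd part
\<open>(a - b)/2 = w + S\<close>, where \<open>S = \<alpha> cos + \<beta> sin\<close>. As \<open>S'' = - S\<close>, replacing \<open>w + S\<close> by \<open>w\<close> changes the
integrand by a derivative of a function of period \<open>\<pi>\<close>; hence \<open>\<alpha>\<close> and \<open>\<beta>\<close> may be arbitrary.
\<close>
lemma defect_identity:
  fixes p p' :: "real \<Rightarrow> real"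
  assumes p: "\<And>t. (p has_real_derivative p' t) (at t)" and cont: "continuous_on UNIV p'"
    and per: "\<And>t. p (t + 2 * pi) = p t"
    and L: "L = integral {0..2 * pi} p"
    and w: "w = (\<lambda>t. (p t - p (t + pi)) / 2 - (\<alpha> * cos t + \<beta> * sin t))"
    and w': "w' = (\<lambda>t. (p' t - p' (t + pi)) / 2 - (\<beta> * cos t - \<alpha> * sin t))"
  shows "L\<^sup>2 - 2 * pi * integral {0..2 * pi} (\<lambda>t. (p t)\<^sup>2 - (p' t)\<^sup>2)
      + pi * integral {0..pi} (\<lambda>t. (p t + p (t + pi) - L / pi)\<^sup>2 - (p' t + p' (t + pi))\<^sup>2)
    = 4 * pi * integral {0..pi} (\<lambda>t. (w' t)\<^sup>2 - (w t)\<^sup>2)"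
proof -
  have contp: "continuous_on UNIV p" using p by (auto intro!: DERIV_continuous_on)
  have shift: "continuous_on UNIV (\<lambda>t. p (t + pi))" "continuous_on UNIV (\<lambda>t. p' (t + pi))"
    by (intro continuous_on_compose2[OF contp] continuous_on_compose2[OF cont] continuous_intros; simp)+
  have ppi: "((\<lambda>t. p (t + pi)) has_real_derivative p' (t + pi)) (at t)" for t
    using p[of "t + pi"] by (simp add: DERIV_shift)
  define S where "S = (\<lambda>t. \<alpha> * cos t + \<beta> * sin t)"
  define S' where "S' = (\<lambda>t. \<beta> * cos t - \<alpha> * sin t)"
  have dS: "(S has_real_derivative S' t) (at t)" for t
    unfolding S_def S'_def by (auto intro!: derivative_eq_intros)
  have dS': "(S' has_real_derivative - S t) (at t)" for t
    unfolding S_def S'_def by (auto intro!: derivative_eq_intros)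
  have dw: "(w has_real_derivative w' t) (at t)" for t
    unfolding w w' by (auto intro!: derivative_eq_intros p ppi)
  have contw: "continuous_on UNIV w" "continuous_on UNIV w'"
    unfolding w w' by (intro continuous_intros contp cont shift; simp)+
  have odd: "p t - p (t + pi) = 2 * (w t + S t)" "p' t - p' (t + pi) = 2 * (w' t + S' t)" for t
    by (simp_all add: w w' S_def S'_def field_simps)
  \<comment> \<open>\<open>h\<close> is the difference of the integrands of the two sides. The terms with \<open>L\<close> integrate to \<open>L\<^sup>2\<close>\<close>
  \<comment> \<open>and undo those that come from expanding \<open>q\<^sup>2\<close>.\<close>
  define h where "h = (\<lambda>t. pi * ((p t + p (t + pi) - L / pi)\<^sup>2 - (p' t + p' (t + pi))\<^sup>2)
      - 2 * pi * (((p t)\<^sup>2 - (p' t)\<^sup>2) + ((p (t + pi))\<^sup>2 - (p' (t + pi))\<^sup>2))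
      - 4 * pi * ((w' t)\<^sup>2 - (w t)\<^sup>2) + 2 * L * (p t + p (t + pi)) - L\<^sup>2 / pi)"
  have h_eq: "h t = 4 * pi * (2 * (w' t * S' t - w t * S t) + ((S' t)\<^sup>2 - (S t)\<^sup>2))" for t
  proof -
    have "h t = pi * ((p' t - p' (t + pi))\<^sup>2 - (p t - p (t + pi))\<^sup>2) - 4 * pi * ((w' t)\<^sup>2 - (w t)\<^sup>2)"
      unfolding h_def by (simp add: power2_eq_square field_simps)
    then show ?thesis unfolding odd by (simp add: power2_eq_square algebra_simps)
  qed
  define Z where "Z = (\<lambda>t. 4 * pi * (2 * (w t * S' t) + S t * S' t))"
  have "(Z has_real_derivative h t) (at t)" for t
    unfolding Z_def h_eq
    by (rule derivative_eq_intros dw dS dS' refl)+ (simp add: power2_eq_square algebra_simps)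
  from has_integral_of_derivative[OF this, of 0 pi]
  have "(h has_integral (Z pi - Z 0)) {0..pi}" by simp
  moreover have "Z pi = Z 0"
  proof -
    have "p (pi + pi) = p 0" using per[of 0] by (metis add_0 mult_2)
    then have "w pi = - w 0" by (simp add: w field_simps)
    moreover have "S pi = - S 0" "S' pi = - S' 0" by (simp_all add: S_def S'_def)
    ultimately show ?thesis by (simp add: Z_def)
  qed
  ultimately have h0: "(h has_integral 0) {0..pi}" by simp
  have const: "((\<lambda>t. L\<^sup>2 / pi) has_integral L\<^sup>2) {0..pi}"
    using has_integral_const_real[of "L\<^sup>2 / pi" 0 pi] by simp
  have h_int: "(h has_integral
       pi * integral {0..pi} (\<lambda>t. (p t + p (t + pi) - L / pi)\<^sup>2 - (p' t + p' (t + pi))\<^sup>2)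
     - 2 * pi * integral {0..pi} (\<lambda>t. ((p t)\<^sup>2 - (p' t)\<^sup>2) + ((p (t + pi))\<^sup>2 - (p' (t + pi))\<^sup>2))
     - 4 * pi * integral {0..pi} (\<lambda>t. (w' t)\<^sup>2 - (w t)\<^sup>2)
     + 2 * L * integral {0..pi} (\<lambda>t. p t + p (t + pi)) - L\<^sup>2) {0..pi}"
    unfolding h_def
    by (intro has_integral_add has_integral_diff has_integral_mult_right integrable_integral
        integrable_on_interval const continuous_intros contp cont shift contw)
  have "0 = pi * integral {0..pi} (\<lambda>t. (p t + p (t + pi) - L / pi)\<^sup>2 - (p' t + p' (t + pi))\<^sup>2)
     - 2 * pi * integral {0..pi} (\<lambda>t. ((p t)\<^sup>2 - (p' t)\<^sup>2) + ((p (t + pi))\<^sup>2 - (p' (t + pi))\<^sup>2))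
     - 4 * pi * integral {0..pi} (\<lambda>t. (w' t)\<^sup>2 - (w t)\<^sup>2)
     + 2 * L * integral {0..pi} (\<lambda>t. p t + p (t + pi)) - L\<^sup>2"
    by (rule has_integral_unique[OF h0 h_int])
  moreover have "integral {0..pi} (\<lambda>t. p t + p (t + pi)) = L"
    unfolding L by (rule integral_two_halves[OF contp, symmetric])
  moreover have "integral {0..pi} (\<lambda>t. ((p t)\<^sup>2 - (p' t)\<^sup>2) + ((p (t + pi))\<^sup>2 - (p' (t + pi))\<^sup>2))
      = integral {0..2 * pi} (\<lambda>t. (p t)\<^sup>2 - (p' t)\<^sup>2)"
    by (rule integral_two_halves[symmetric]) (intro continuous_intros contp cont)
  ultimately show ?thesis
    by (simp add: power2_eq_square)
qed

lemma support_fn_steiner_symmetral: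
  assumes "compact K" "K \<noteq> {}"
  shows "support_fn (frontier (steiner_symmetral K)) \<theta> = steiner_point K \<bullet> direction \<theta>
     + (support_fn (frontier K) \<theta> + support_fn (frontier K) (\<theta> + pi)) / 2"
proof -
  obtain b where b: "b \<in> K" "support_fn (frontier K) \<theta> = b \<bullet> direction \<theta>"
    "\<And>y. y \<in> K \<Longrightarrow> y \<bullet> direction \<theta> \<le> b \<bullet> direction \<theta>"
    using support_fn_attained[OF assms] by blast
  obtain d where d: "d \<in> K" "support_fn (frontier K) (\<theta> + pi) = - (d \<bullet> direction \<theta>)"
    "\<And>y. y \<in> K \<Longrightarrow> d \<bullet> direction \<theta> \<le> y \<bullet> direction \<theta>"
    using support_fn_attained[OF assms, of "\<theta> + pi"] by (auto simp: direction_plus_pi)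
  have "compact (uminus ` K)"
    by (intro compact_continuous_image continuous_intros assms)
  from compact_sums[OF assms(1) this] have "compact (minkowski_sum K (uminus ` K))"
    by (simp add: minkowski_sum_def)
  then have "compact (steiner_symmetral K)"
    unfolding steiner_symmetral_def by (intro compact_continuous_image continuous_intros)
  then have closed: "closed (steiner_symmetral K)" by (rule compact_imp_closed)
  have mem: "v \<in> steiner_symmetral K \<longleftrightarrow> (\<exists>x\<in>K. \<exists>y\<in>K. v = steiner_point K + (1/2) *\<^sub>R (x - y))" for v
    unfolding steiner_symmetral_def minkowski_sum_def image_iff by (auto 0 4 simp: Bex_def)
  have "support_fn (frontier (steiner_symmetral K)) \<theta> = (steiner_point K + (1/2) *\<^sub>R (b - d)) \<bullet> direction \<theta>"
  proof (rule support_fn_frontier_eqI[OF closed])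
    show "steiner_point K + (1/2) *\<^sub>R (b - d) \<in> steiner_symmetral K"
      unfolding mem using b(1) d(1) by blast
    show "v \<bullet> direction \<theta> \<le> (steiner_point K + (1/2) *\<^sub>R (b - d)) \<bullet> direction \<theta>"
      if v: "v \<in> steiner_symmetral K" for v
    proof -
      obtain x y where "x \<in> K" "y \<in> K" "v = steiner_point K + (1/2) *\<^sub>R (x - y)"
        using v unfolding mem by blast
      then show ?thesis using b(3)[of x] d(3)[of y] by (simp add: inner_add_left inner_diff_left)
    qed
  qed
  then show ?thesis by (simp add: b(2) d(2) inner_add_left inner_diff_left)
qed

text \<open>
Green's formula gives \<open>2A = \<integral> (p + p'') (p - z \<bullet> u)\<close> for an interior point \<open>z\<close>, which makes the curve
starlike wherever the origin is. The function \<open>(z \<bullet> u) p' - (z \<bullet> u') p - p p'\<close> is periodic and its derivative is the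
difference to \<open>p\<^sup>2 - p'\<^sup>2\<close>, so \<open>z\<close> drops out.
\<close>
lemma area_via_support_function:
  fixes p' p'' :: "real \<Rightarrow> real"
  assumes K: "strictly_convex_domain K"
    and p: "\<And>t. (support_fn (frontier K) has_real_derivative p' t) (at t)"
    and p': "\<And>t. (p' has_real_derivative p'' t) (at t)"
    and cont: "continuous_on UNIV p''"
    and pos: "\<And>t. 0 < support_fn (frontier K) t + p'' t"
    and M: "range (support_param (frontier K)) = frontier K"
    and inj: "\<And>s t. support_param (frontier K) s = support_param (frontier K) t \<Longrightarrow> \<exists>k::int. s = t + 2 * pi * k"
  shows "2 * measure lebesgue K = integral {0..2 * pi} (\<lambda>t. (support_fn (frontier K) t)\<^sup>2 - (p' t)\<^sup>2)"
proof -
  define P where "P = support_fn (frontier K)"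
  define g where "g = support_param (frontier K)"
  have dP: "(P has_real_derivative p' t) (at t)" for t using p by (simp add: P_def)
  have contp: "continuous_on UNIV P" "continuous_on UNIV p'"
    using dP p' by (auto intro!: DERIV_continuous_on)
  have per: "P (t + 2 * pi) = P t" for t by (simp add: P_def support_fn_def direction_periodic)
  have per': "p' (t + 2 * pi) = p' t" for t
  proof -
    have "((\<lambda>t. P (t + 2 * pi)) has_real_derivative p' (t + 2 * pi)) (at t)"
      using dP[of "t + 2 * pi"] by (simp only: DERIV_shift)
    then show ?thesis using dP[of t] unfolding per by (rule DERIV_unique)
  qed
  have "deriv P t = p' t" for t using dP by (rule DERIV_imp_deriv)
  then have g: "g = (\<lambda>t. vector [P t * cos t - p' t * sin t, P t * sin t + p' t * cos t])"
    by (auto simp: g_def support_param_def P_def)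
  define g' :: "real \<Rightarrow> real^2" where "g' = (\<lambda>t. (P t + p'' t) *\<^sub>R vector [- sin t, cos t])"
  have dg: "(g has_vector_derivative g' t) (at t)" for t
    unfolding g g'_def by (rule support_curve_derivative[OF dP p'])
  have g'_eq: "g' = (\<lambda>t. ((P t + p'' t) * - sin t) *\<^sub>R vector [1, 0] + ((P t + p'' t) * cos t) *\<^sub>R vector [0, 1])"
    unfolding g'_def by (rule ext) (simp add: vec_eq_iff forall_2)
  have contg': "continuous_on UNIV g'"
    unfolding g'_eq by (intro continuous_intros contp cont)
  obtain z where z: "z \<in> interior K"
    using K by (auto simp: strictly_convex_domain_def)
  have compK: "compact K" using K by (simp add: strictly_convex_domain_def)
  have cr: "cross2 (g t - z) (g' t) = (P t + p'' t) * (P t - z \<bullet> direction t)" for t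
  proof -
    have "g t $ 1 * cos t + g t $ 2 * sin t = P t * (cos t * cos t + sin t * sin t)"
      unfolding g vector_2 by algebra
    then have gu: "g t $ 1 * cos t + g t $ 2 * sin t = P t"
      by (simp only: sin_cos_squared_add3 mult_1_right)
    have "cross2 (g t - z) (g' t) = (P t + p'' t) * ((g t $ 1 * cos t + g t $ 2 * sin t) - z \<bullet> direction t)"
      unfolding cross2_def g'_def inner_direction by (simp add: algebra_simps)
    then show ?thesis by (simp only: gu)
  qed
  have star: "0 < cross2 (g t - z) (g' t)" for t
  proof -
    obtain y where y: "y \<in> K" "z \<bullet> direction t < y \<bullet> direction t"
      using interior_point_exceeded[OF z] by blast
    have "K \<noteq> {}" using y(1) by blast
    then obtain b where "P t = b \<bullet> direction t" "\<And>y. y \<in> K \<Longrightarrow> y \<bullet> direction t \<le> b \<bullet> direction t"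
      unfolding P_def using support_fn_attained[OF compK] by metis
    with y have "z \<bullet> direction t < P t" by force
    then show ?thesis unfolding cr using pos by (simp add: P_def)
  qed
  have gper: "g (t + 2 * pi) = g t" for t by (simp add: g per per')
  have "measure lebesgue K = (1/2) * integral {0..2 * pi} (\<lambda>t. cross2 (g t - z) (g' t))"
    by (rule area_of_starlike_curve[OF K z _ dg contg' gper _ star]) (use M inj in \<open>auto simp: g_def\<close>)
  then have A: "2 * measure lebesgue K = integral {0..2 * pi} (\<lambda>t. (P t + p'' t) * (P t - z \<bullet> direction t))"
    by (simp add: cr)
  define Z where "Z = (\<lambda>t. (z $ 1 * cos t + z $ 2 * sin t) * p' t - (z $ 2 * cos t - z $ 1 * sin t) * P t - P t * p' t)"
  have "(Z has_real_derivative ((P t)\<^sup>2 - (p' t)\<^sup>2) - (P t + p'' t) * (P t - z \<bullet> direction t)) (at t)" for t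
    unfolding Z_def inner_direction
    by (rule derivative_eq_intros dP p' refl)+ (simp add: power2_eq_square algebra_simps)
  from has_integral_of_derivative[OF this, of 0 "2 * pi"]
  have "((\<lambda>t. ((P t)\<^sup>2 - (p' t)\<^sup>2) - (P t + p'' t) * (P t - z \<bullet> direction t)) has_integral 0) {0..2 * pi}"
    using per[of 0] per'[of 0] by (simp add: Z_def)
  moreover have "((\<lambda>t. ((P t)\<^sup>2 - (p' t)\<^sup>2) - (P t + p'' t) * (P t - z \<bullet> direction t)) has_integral
     integral {0..2 * pi} (\<lambda>t. (P t)\<^sup>2 - (p' t)\<^sup>2) - integral {0..2 * pi} (\<lambda>t. (P t + p'' t) * (P t - z \<bullet> direction t))) {0..2 * pi}"
    unfolding inner_direction
    by (intro has_integral_diff integrable_integral integrable_on_interval continuous_intros contp cont)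
  ultimately show ?thesis
    unfolding A by (auto dest: has_integral_unique simp: P_def)
qed

section \<open>The stability inequality\<close>
theorem theorem6p10:
  fixes K :: "(real^2) set"
  assumes "strictly_convex_domain K"
    and "oval (frontier K)"
  shows "(oval_length (frontier K))\<^sup>2 - 4 * pi * measure lebesgue K
           - pi * \<bar>oriented_area (CWMS (frontier K))\<bar>
         \<ge> 8 * pi\<^sup>2 * (d_infty K (steiner_symmetral K))\<^sup>2
       \<and> ((oval_length (frontier K))\<^sup>2 - 4 * pi * measure lebesgue K
           - pi * \<bar>oriented_area (CWMS (frontier K))\<bar>
         = 8 * pi\<^sup>2 * (d_infty K (steiner_symmetral K))\<^sup>2
         \<longleftrightarrow> centrally_symmetric (frontier K))"
proof -
  \<comment> \<open>The parametrization that \<open>oval_length\<close> selects is the one from which \<open>p\<close> is studied.\<close>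
  define c where "c = (SOME c. oval_param c \<and> c ` {0..2 * pi} = frontier K)"
  have "\<exists>c. oval_param c \<and> c ` {0..2 * pi} = frontier K" using assms(2) by (simp add: oval_def)
  from someI_ex[OF this] have c: "oval_param c" "c ` {0..2 * pi} = frontier K" unfolding c_def by blast+
  define p where "p = support_fn (frontier K)"
  define g where "g = support_param (frontier K)"
  define L where "L = oval_length (frontier K)"
  obtain p' p'' where dp0: "\<And>t. (support_fn (frontier K) has_real_derivative p' t) (at t)"
    and dp': "\<And>t. (p' has_real_derivative p'' t) (at t)"
    and contp'': "continuous_on UNIV p''"
    and pos: "\<And>t. 0 < support_fn (frontier K) t + p'' t"
    and len: "integral {0..2 * pi} (support_fn (frontier K)) = curve_length c"
    and M: "range (support_param (frontier K)) = frontier K"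
    and inj: "\<And>s t. support_param (frontier K) s = support_param (frontier K) t \<Longrightarrow> \<exists>k::int. s = t + 2 * pi * k"
    using support_of_oval[OF assms(1) c] by blast
  have area: "2 * measure lebesgue K = integral {0..2 * pi} (\<lambda>t. (p t)\<^sup>2 - (p' t)\<^sup>2)"
    unfolding p_def by (rule area_via_support_function[OF assms(1) dp0 dp' contp'' pos M inj])
  have L: "L = integral {0..2 * pi} p"
    using len by (simp add: L_def oval_length_def c_def p_def)
  have compK: "compact K" and "K \<noteq> {}" using assms(1) by (auto simp: strictly_convex_domain_def)
  have dp: "(p has_real_derivative p' t) (at t)" for t using dp0 by (simp add: p_def)
  have contp: "continuous_on UNIV p" "continuous_on UNIV p'"
    using dp dp' by (auto intro!: DERIV_continuous_on)
  have per: "p (t + 2 * pi) = p t" for t by (simp add: p_def support_fn_def direction_periodic)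
  have per': "p' (t + 2 * pi) = p' t" for t
  proof -
    have "((\<lambda>t. p (t + 2 * pi)) has_real_derivative p' (t + 2 * pi)) (at t)"
      using dp[of "t + 2 * pi"] by (simp only: DERIV_shift)
    then show ?thesis using dp[of t] unfolding per by (rule DERIV_unique)
  qed
  have twice: "t + pi + pi = t + 2 * pi" for t :: real by simp
  have shift: "continuous_on UNIV (\<lambda>t. p (t + pi))" "continuous_on UNIV (\<lambda>t. p' (t + pi))" "continuous_on UNIV (\<lambda>t. p'' (t + pi))"
    by (intro continuous_on_compose2[OF contp(1)] continuous_on_compose2[OF contp(2)] continuous_on_compose2[OF contp''] continuous_intros; simp)+
  have dpi: "((\<lambda>t. p (t + pi)) has_real_derivative p' (t + pi)) (at t)" for t
    using dp[of "t + pi"] by (simp add: DERIV_shift)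
  have dpi': "((\<lambda>t. p' (t + pi)) has_real_derivative p'' (t + pi)) (at t)" for t
    using dp'[of "t + pi"] by (simp add: DERIV_shift)
  have "deriv p t = p' t" for t using dp by (rule DERIV_imp_deriv)
  then have g: "g = (\<lambda>t. vector [p t * cos t - p' t * sin t, p t * sin t + p' t * cos t])"
    by (auto simp: g_def support_param_def p_def)
  define q where "q = (\<lambda>t. p t + p (t + pi) - L / pi)"
  define q' where "q' = (\<lambda>t. p' t + p' (t + pi))"
  have dq: "(q has_real_derivative q' t) (at t)" for t
    unfolding q_def q'_def using DERIV_diff[OF DERIV_add[OF dp dpi] DERIV_const] by simp
  have dq': "(q' has_real_derivative p'' t + p'' (t + pi)) (at t)" for t
    unfolding q'_def by (rule DERIV_add[OF dp' dpi'])
  have qper: "q (t + pi) = q t" "q' (t + pi) = q' t" for t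
    unfolding q_def q'_def twice per per' by simp_all
  have contq': "continuous_on UNIV q'" unfolding q'_def by (intro continuous_intros contp shift)
  have "CWMS (frontier K) = (\<lambda>t. vector [q t * cos t - q' t * sin t, q t * sin t + q' t * cos t])"
    unfolding CWMS_def g_def[symmetric] L_def[symmetric] g
    by (rule ext) (simp add: q_def q'_def direction_def vec_eq_iff forall_2 algebra_simps)
  then have CW: "oriented_area (CWMS (frontier K)) = integral {0..pi} (\<lambda>t. (q t)\<^sup>2 - (q' t)\<^sup>2)"
    using oriented_area_support_curve[OF dq dq' _ qper] by (simp add: continuous_intros contp'' shift)
  have "integral {0..pi} q = integral {0..pi} (\<lambda>t. p t + p (t + pi)) - integral {0..pi} (\<lambda>t. L / pi)"
    unfolding q_def by (intro integral_diff integrable_on_interval continuous_intros contp shift)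
  also have "integral {0..pi} (\<lambda>t. p t + p (t + pi)) = L"
    unfolding L by (rule integral_two_halves[OF contp(1), symmetric])
  finally have "integral {0..pi} q = 0" by simp
  from Wirtinger_mean_zero[OF dq contq' qper(1) this]
  have "0 \<le> integral {0..pi} (\<lambda>t. - ((q t)\<^sup>2 - (q' t)\<^sup>2))" by simp
  then have "integral {0..pi} (\<lambda>t. (q t)\<^sup>2 - (q' t)\<^sup>2) \<le> 0"
    unfolding integral_neg by simp
  with CW have absCW: "\<bar>oriented_area (CWMS (frontier K))\<bar> = - integral {0..pi} (\<lambda>t. (q t)\<^sup>2 - (q' t)\<^sup>2)"
    by simp
  \<comment> \<open>The definition of the Steiner point makes \<open>s \<bullet> u\<close> the first harmonic of \<open>p\<close>, so that subtracting it\<close>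
  \<comment> \<open>leaves \<open>w\<close> orthogonal to \<open>cos\<close> and \<open>sin\<close>.\<close>
  define s where "s = steiner_point K"
  have contpd: "continuous_on {0..2 * pi} (\<lambda>t. p t *\<^sub>R direction t)"
  proof -
    have eq: "(\<lambda>t. p t *\<^sub>R direction t) = (\<lambda>t. (p t * cos t) *\<^sub>R vector [1, 0] + (p t * sin t) *\<^sub>R vector [0, 1])"
      by (rule ext) (simp add: direction_def vec_eq_iff forall_2)
    have "continuous_on {0..2 * pi} p" by (rule continuous_on_subset[OF contp(1) subset_UNIV])
    then show ?thesis
      unfolding eq by (intro continuous_intros)
  qed
  have s_int: "s $ i = (1 / pi) * integral {0..2 * pi} (\<lambda>t. p t * direction t $ i)" for i
    using integral_component_eq_cart[OF integrable_continuous_interval[OF contpd], of i]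
    by (simp add: s_def steiner_point_def p_def)
  define w where "w = (\<lambda>t. (p t - p (t + pi)) / 2 - (s $ 1 * cos t + s $ 2 * sin t))"
  define w' where "w' = (\<lambda>t. (p' t - p' (t + pi)) / 2 - (s $ 2 * cos t - s $ 1 * sin t))"
  have dw: "(w has_real_derivative w' t) (at t)" for t
    unfolding w_def w'_def by (auto intro!: derivative_eq_intros dp dpi)
  have contw: "continuous_on UNIV w" "continuous_on UNIV w'"
    unfolding w_def w'_def by (intro continuous_intros contp shift; simp)+
  have anti: "w (t + pi) = - w t" for t
    unfolding w_def twice per by (simp add: field_simps)
  have fold: "integral {0..pi} (\<lambda>t. (p t - p (t + pi)) / 2 * f t) = integral {0..2 * pi} (\<lambda>t. p t * f t) / 2"
    if f: "continuous_on UNIV f" "\<And>t. f (t + pi) = - f t" for f :: "real \<Rightarrow> real"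
  proof -
    have "integral {0..2 * pi} (\<lambda>t. p t * f t) = integral {0..pi} (\<lambda>t. p t * f t + p (t + pi) * f (t + pi))"
      by (rule integral_two_halves) (intro continuous_intros contp f)
    also have "\<dots> = integral {0..pi} (\<lambda>t. 2 * ((p t - p (t + pi)) / 2 * f t))"
      unfolding f(2) by (rule integral_cong) (simp add: left_diff_distrib)
    also have "\<dots> = 2 * integral {0..pi} (\<lambda>t. (p t - p (t + pi)) / 2 * f t)"
      by (rule integral_mult_right)
    finally show ?thesis by simp
  qed
  have w_split: "integral {0..pi} (\<lambda>t. w t * f t) = integral {0..pi} (\<lambda>t. (p t - p (t + pi)) / 2 * f t)
      - integral {0..pi} (\<lambda>t. (s $ 1 * cos t + s $ 2 * sin t) * f t)"
    if f: "continuous_on UNIV f" for f :: "real \<Rightarrow> real"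
    unfolding w_def left_diff_distrib
    by (intro integral_diff integrable_on_interval continuous_intros contp shift f; simp)
  have orthc: "integral {0..pi} (\<lambda>t. w t * cos t) = 0"
  proof -
    have "s $ 1 * pi = integral {0..2 * pi} (\<lambda>t. p t * cos t)"
      unfolding s_int by (simp add: direction_def)
    then show ?thesis
      using w_split[of cos] fold[of cos] by (simp add: integral_trig_cos continuous_intros)
  qed
  have orths: "integral {0..pi} (\<lambda>t. w t * sin t) = 0"
  proof -
    have "s $ 2 * pi = integral {0..2 * pi} (\<lambda>t. p t * sin t)"
      unfolding s_int by (simp add: direction_def)
    then show ?thesis
      using w_split[of sin] fold[of sin] by (simp add: integral_trig_sin continuous_intros)
  qed
  define Q where "Q = integral {0..pi} (\<lambda>t. (w' t)\<^sup>2 - (w t)\<^sup>2)"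
  have four_area: "4 * pi * measure lebesgue K = 2 * pi * integral {0..2 * pi} (\<lambda>t. (p t)\<^sup>2 - (p' t)\<^sup>2)"
    unfolding area[symmetric] by simp
  have lhs: "(oval_length (frontier K))\<^sup>2 - 4 * pi * measure lebesgue K
           - pi * \<bar>oriented_area (CWMS (frontier K))\<bar> = 4 * pi * Q"
    using defect_identity[OF dp contp(2) per L w_def w'_def]
    unfolding four_area absCW L_def[symmetric] Q_def q_def q'_def by simp
  have dist_eq: "support_fn (frontier K) t - support_fn (frontier (steiner_symmetral K)) t = w t" for t
    unfolding support_fn_steiner_symmetral[OF compK \<open>K \<noteq> {}\<close>] s_def[symmetric] p_def[symmetric] inner_direction
    by (simp add: w_def field_simps)
  have "continuous_on {0..2 * pi} (\<lambda>t. \<bar>w t\<bar>)"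
    by (intro continuous_intros continuous_on_subset[OF contw(1)] subset_UNIV)
  then have "\<exists>t0\<in>{0..2 * pi}. \<forall>t\<in>{0..2 * pi}. \<bar>w t\<bar> \<le> \<bar>w t0\<bar>"
    by (intro continuous_attains_sup) auto
  then obtain t0 where t0: "\<And>t. t \<in> {0..2 * pi} \<Longrightarrow> \<bar>w t\<bar> \<le> \<bar>w t0\<bar>"
    by blast
  have wper: "w (t + 2 * pi) = w t" for t
    using anti[of t] anti[of "t + pi"] by (simp add: twice)
  have max: "\<bar>w t\<bar> \<le> \<bar>w t0\<bar>" for t
  proof -
    obtain i :: int where i: "t + 2 * pi * i \<in> {0..<2 * pi}"
      using reduce_modulo_period[of "2 * pi" t] by auto
    then show ?thesis
      using t0[of "t + 2 * pi * i"] periodic_of_int[of w "2 * pi" t i, OF wper] by auto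
  qed
  have d: "d_infty K (steiner_symmetral K) = \<bar>w t0\<bar>"
    unfolding d_infty_def dist_eq by (rule cSup_eq_maximum) (use max in auto)
  have ineq: "2 * pi * (w t0)\<^sup>2 \<le> Q" and eq: "Q = 2 * pi * (w t0)\<^sup>2 \<Longrightarrow> w t0 = 0"
    unfolding Q_def using antiperiodic_sup_bound[OF dw contw(2) anti orthc orths, of t0] by blast+
  have rhs: "8 * pi\<^sup>2 * (d_infty K (steiner_symmetral K))\<^sup>2 = 4 * pi * (2 * pi * (w t0)\<^sup>2)"
    by (simp add: d power2_eq_square)
  have sym: "Q = 2 * pi * (w t0)\<^sup>2 \<longleftrightarrow> centrally_symmetric (frontier K)"
  proof
    assume "Q = 2 * pi * (w t0)\<^sup>2"
    then have w0: "w t = 0" for t using eq max[of t] by simp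
    have w0': "w' t = 0" for t
    proof -
      have "w = (\<lambda>t. 0)" using w0 by auto
      then show ?thesis using dw[of t] DERIV_unique[of w "w' t" t 0] by simp
    qed
    have reflect: "2 *\<^sub>R s - g t = g (t + pi)" for t
    proof -
      define S where "S = s $ 1 * cos t + s $ 2 * sin t"
      define S' where "S' = s $ 2 * cos t - s $ 1 * sin t"
      have s1: "s $ 1 = S * cos t - S' * sin t" and s2: "s $ 2 = S * sin t + S' * cos t"
        unfolding S_def S'_def by (rule coordinates_in_rotated_frame[symmetric])+
      have e1: "p (t + pi) = p t - 2 * S" using w0[of t] by (simp add: w_def S_def)
      have e2: "p' (t + pi) = p' t - 2 * S'" using w0'[of t] by (simp add: w'_def S'_def)
      show ?thesis unfolding g e1 e2
        by (simp add: vec_eq_iff forall_2 s1 s2 algebra_simps)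
    qed
    have M': "frontier K = range g" using M by (simp add: g_def)
    have "range (\<lambda>t. t + pi) = UNIV" by (rule surjI[of _ "\<lambda>t. t - pi"]) simp
    then have "range (\<lambda>t. g (t + pi)) = range g" by (metis image_image)
    then have "(\<lambda>x. 2 *\<^sub>R s - x) ` frontier K = frontier K"
      unfolding M' image_image reflect .
    then show "centrally_symmetric (frontier K)" unfolding centrally_symmetric_def by blast
  next
    assume "centrally_symmetric (frontier K)"
    then obtain z where z: "(\<lambda>x. 2 *\<^sub>R z - x) ` frontier K = frontier K"
      unfolding centrally_symmetric_def by blast
    have closedK: "closed K" using compK by (rule compact_imp_closed)
    have pz: "p t - p (t + pi) = 2 * (z \<bullet> direction t)" for t
    proof -
      obtain b where b: "b \<in> K" "support_fn (frontier K) (t + pi) = b \<bullet> direction (t + pi)"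
        "\<And>y. y \<in> K \<Longrightarrow> y \<bullet> direction (t + pi) \<le> b \<bullet> direction (t + pi)"
        using support_fn_attained[OF compK \<open>K \<noteq> {}\<close>] by blast
      have bF: "b \<in> frontier K" using maximizer_in_frontier[OF closedK b(1,3)] .
      have "p t = (2 *\<^sub>R z - b) \<bullet> direction t"
        unfolding p_def
      proof (rule support_fn_eqI)
        show "2 *\<^sub>R z - b \<in> frontier K" using z bF by blast
        show "y \<bullet> direction t \<le> (2 *\<^sub>R z - b) \<bullet> direction t" if y: "y \<in> frontier K" for y
        proof -
          have "2 *\<^sub>R z - y \<in> frontier K" using z y by blast
          then have "2 *\<^sub>R z - y \<in> K" using frontier_subset_closed[OF closedK] by blast
          from b(3)[OF this] show ?thesis
            by (simp add: direction_plus_pi inner_diff_left)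
        qed
      qed
      moreover have "p (t + pi) = - (b \<bullet> direction t)"
        using b(2) by (simp add: p_def direction_plus_pi)
      ultimately show ?thesis by (simp add: inner_diff_left)
    qed
    \<comment> \<open>A center of symmetry must be the Steiner point, because \<open>w\<close> has no first harmonics.\<close>
    have w_eq: "w t = (z $ 1 - s $ 1) * cos t + (z $ 2 - s $ 2) * sin t" for t
      unfolding w_def pz inner_direction by (simp add: algebra_simps)
    have "z $ 1 - s $ 1 = 0" "z $ 2 - s $ 2 = 0"
      using orthc orths unfolding w_eq integral_trig_cos integral_trig_sin by simp_all
    then have w0: "w = (\<lambda>t. 0)" using w_eq by auto
    have "w' t = 0" for t
      using dw[of t] unfolding w0 by (rule DERIV_unique) simp
    then show "Q = 2 * pi * (w t0)\<^sup>2" by (simp add: Q_def w0)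
  qed
  have "4 * pi * (2 * pi * (w t0)\<^sup>2) \<le> 4 * pi * Q"
    by (rule mult_left_mono[OF ineq]) simp
  moreover have "4 * pi * Q = 4 * pi * X \<longleftrightarrow> Q = X" for X by simp
  ultimately show ?thesis
    unfolding lhs rhs using sym by blast
qed

end
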